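(* Let $\boldsymbol p\in\mathbb N_0^2$. The operator product of elements of a coupled basis of $\boldsymbol p\otimes\check{\boldsymbol p}$ can be decomposed as $$\boldsymbol e((\boldsymbol a_1;\sigma_1);\boldsymbol\nu_1,J_1)\,\boldsymbol e((\boldsymbol a_2;\sigma_2);\boldsymbol\nu_2,J_2)=\sum_{\substack{(\boldsymbol a;\sigma)\\ \boldsymbol\nu,J}}(-1)^{|\boldsymbol p|+2(t_{\boldsymbol\nu}+u_{\boldsymbol\nu})}\begin{bmatrix}(\boldsymbol a_1;\sigma_1)&(\boldsymbol a_2;\sigma_2)&(\boldsymbol a;\sigma)\\ \boldsymbol\nu_1,J_1&\boldsymbol\nu_2,J_2&\check{\boldsymbol\nu},J\end{bmatrix}[\boldsymbol p]\;\boldsymbol e((\boldsymbol a;\sigma);\boldsymbol\nu,J),$$ where summation over $(\boldsymbol a;\sigma)$ is restricted to the Clebsch-Gordan series of $\boldsymbol p\otimes\check{\boldsymbol p}$, and summations over $\boldsymbol\nu$ and $J$ are effectively restricted by $t_{\boldsymbol\nu}=t_{\boldsymbol\nu_1}+t_{\boldsymbol\nu_2}$, $u_{\boldsymbol\nu}=u_{\boldsymbol\nu_1}+u_{\boldsymbol\nu_2}$ and $\delta(J_1,J_2,J)=1$ (the other terms vanish).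
   Context: Representations. In a representation of $SU(3)$ (extended to $\mathfrak{sl}(3,\mathbb C)$) let $T_+,T_-,T_3,U_+,U_-,U_3$ be the images of $E_{12},E_{21},\tfrac12(E_{11}-E_{22}),E_{23},E_{32},\tfrac12(E_{22}-E_{33})$. For $\boldsymbol p=(p,q)\in\mathbb N_0^2$, "the irrep $\boldsymbol p$" is the unitary irrep on $\mathcal H_{\boldsymbol p}$ whose highest weight vector has eigenvalue $p/2$ for $T_3$ and $q/2$ for $U_3$; $|\boldsymbol p|=p+q$, $\check{\boldsymbol p}=(q,p)$ (the dual irrep). Inner products are linear in the second entry. Gelfand-Tsetlin (GT) basis: an orthonormal basis $\{\boldsymbol e(\boldsymbol p;\boldsymbol\nu,J)\}$ indexed by $\boldsymbol\nu=(\nu_1,\nu_2,\nu_3)$ and $J$ where, for integers $0\le r_-\le q\le r_+\le p+q$ and $r_-\le\nu_3\le r_+$: $\nu_1=p+2q-(r_++r_-)$, $\nu_2=r_++r_--\nu_3$, $J=\frac12(r_+-r_-)$. Put $t_{\boldsymbol\nu}=\frac{\nu_1-\nu_2}2$, $u_{\boldsymbol\nu}=\frac{\nu_2-\nu_3}2$ (the eigenvalues of $T_3,U_3$). The basis is determined by a unit highest weight vector $\boldsymbol e(\boldsymbol p;(p+q,q,0),q/2)$ via, with $u=u_{\boldsymbol\nu}$, $U_-\boldsymbol e(\boldsymbol p;\boldsymbol\nu,J)=\sqrt{(J+u)(J-u+1)}\,\boldsymbol e(\boldsymbol p;(\nu_1,\nu_2-1,\nu_3+1),J)$ and $T_-\boldsymbol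 e(\boldsymbol p;\boldsymbol\nu,J)=\sqrt{\tfrac{(J-u)(p+q+J-u-\nu_3+1)(q+J-u-\nu_3)(u-J+\nu_3+1)}{2J(2J+1)}}\,\boldsymbol e(\boldsymbol p;(\nu_1-1,\nu_2+1,\nu_3),J-\tfrac12)+\sqrt{\tfrac{(J+u+1)(p+q-J-u-\nu_3)(J+u+1+\nu_3-q)(J+u+2+\nu_3)}{2(J+1)(2J+1)}}\,\boldsymbol e(\boldsymbol p;(\nu_1-1,\nu_2+1,\nu_3),J+\tfrac12)$ (terms with zero numerator are $0$). For a GT label $\boldsymbol\nu$ of an irrep $\boldsymbol a$ put $\check{\boldsymbol\nu}=(|\boldsymbol a|,|\boldsymbol a|,|\boldsymbol a|)-\boldsymbol\nu$, a GT label of $\check{\boldsymbol a}$. The induced GT basis of $\mathcal H_{\check{\boldsymbol p}}=\mathcal H_{\boldsymbol p}^*$ is $\check{\boldsymbol e}(\check{\boldsymbol p};\check{\boldsymbol\nu},J)=(-1)^{2(t_{\boldsymbol\nu}+u_{\boldsymbol\nu})}\boldsymbol e^*(\boldsymbol p;\boldsymbol\nu,J)$. Coupled basis. $\mathcal B(\mathcal H_{\boldsymbol p})\simeq\mathcal H_{\boldsymbol p}\otimes\mathcal H_{\boldsymbol p}^*$ (the representation $\boldsymbol p\otimes\check{\boldsymbol p}$) is decomposed orthogonally into irreps $(\boldsymbol a;\sigma)$ of class $\boldsymbol a$, $\sigma$ running from $1$ to the multiplicity of $\boldsymbol a$ (the Clebsch-Gordan series). A coupled basis is the union of GT bases $\boldsymbol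 e((\boldsymbol a;\sigma);\boldsymbol\nu,J)$ of the $(\boldsymbol a;\sigma)$. Clebsch-Gordan coefficients: $C^{\boldsymbol p,\check{\boldsymbol p},(\boldsymbol a;\sigma)}_{\boldsymbol\nu_1J_1,\boldsymbol\nu_2J_2,\boldsymbol\nu J}=\langle\boldsymbol e((\boldsymbol a;\sigma);\boldsymbol\nu,J)|\boldsymbol e(\boldsymbol p;\boldsymbol\nu_1,J_1)\otimes\check{\boldsymbol e}(\check{\boldsymbol p};\boldsymbol\nu_2,J_2)\rangle$; decomposition and phases are chosen so that these are all real. Wigner product symbol: for $(\boldsymbol a_1;\sigma_1),(\boldsymbol a_2;\sigma_2),(\boldsymbol a;\sigma)$ in the Clebsch-Gordan series of $\boldsymbol p\otimes\check{\boldsymbol p}$, GT labels $(\boldsymbol\nu_i,J_i)$ of $\boldsymbol a_i$ and $(\boldsymbol\nu,J)$ of $\check{\boldsymbol a}$, $$\begin{bmatrix}(\boldsymbol a_1;\sigma_1)&(\boldsymbol a_2;\sigma_2)&(\boldsymbol a;\sigma)\\ \boldsymbol\nu_1,J_1&\boldsymbol\nu_2,J_2&\boldsymbol\nu,J\end{bmatrix}[\boldsymbol p]=\sum_{\substack{\boldsymbol\mu_1,\boldsymbol\mu_2,\boldsymbol\mu_3\\ I_1,I_2,I_3}}(-1)^{|\boldsymbol p|+2(t_{\boldsymbol\nu}+t_{\boldsymbol\mu_2}+u_{\boldsymbol\nu}+u_{\boldsymbol\mu_2})}C^{\boldsymbol p,\check{\boldsymbol p},(\boldsymbol a_1;\sigma_1)}_{\boldsymbol\mu_1I_1,\boldsymbol\mu_2I_2,\boldsymbol\nu_1J_1}C^{\boldsymbol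 p,\check{\boldsymbol p},(\boldsymbol a_2;\sigma_2)}_{\check{\boldsymbol\mu}_2I_2,\boldsymbol\mu_3I_3,\boldsymbol\nu_2J_2}C^{\boldsymbol p,\check{\boldsymbol p},(\boldsymbol a;\sigma)}_{\boldsymbol\mu_1I_1,\boldsymbol\mu_3I_3,\check{\boldsymbol\nu}J},$$ the sum being over GT labels $(\boldsymbol\mu_1,I_1)$ of $\boldsymbol p$ and $(\boldsymbol\mu_2,I_2),(\boldsymbol\mu_3,I_3)$ of $\check{\boldsymbol p}$. $\delta(x,y,z)=1$ if $x,y,z$ satisfy the triangle inequality and $x+y+z\in\mathbb Z$, and $0$ otherwise. *)

theory Defs
  imports "HOL-Analysis.Analysis"
begin

text \<open>
  A complex Hilbert space of finite dimension is \<^typ>\<open>complex^'m\<close> with the standard inner product,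
  and its linear operators are the matrices \<^typ>\<open>complex^'m^'m\<close> with product \<open>**\<close>.
  Complex subspaces and spans are \<open>vec.subspace\<close> and \<open>vec.span\<close>.
\<close>

definition cinner :: "complex^'m \<Rightarrow> complex^'m \<Rightarrow> complex" where
  "cinner v w = (\<Sum>i\<in>UNIV. cnj (v $ i) * w $ i)"

definition adj :: "complex^'m^'m \<Rightarrow> complex^'m^'m" where
  "adj A = (\<chi> i j. cnj (A $ j $ i))"

definition cscale :: "complex \<Rightarrow> complex^'m^'m \<Rightarrow> complex^'m^'m" where
  "cscale c A = (\<chi> i j. c * A $ i $ j)"

definition commutator :: "complex^'m^'m \<Rightarrow> complex^'m^'m \<Rightarrow> complex^'m^'m" where
  "commutator A B = A ** B - B ** A"


section \<open>Representations of SU(3) and their extension to sl(3)\<close>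

definition SU3 :: "(complex^3^3) set" where
  "SU3 = {g. adj g ** g = mat 1 \<and> det g = 1}"

definition sl3 :: "(complex^3^3) set" where
  "sl3 = {X. trace X = 0}"

text \<open>
  A unitary representation \<open>\<pi>\<close> of SU(3) together with its extension \<open>\<rho>\<close> to sl(3): the
  complex-linear representation of sl(3) that restricts on su(3) to the differential of \<open>\<pi>\<close>
  at the identity. The differential is expressed through curves in SU(3) starting at the
  identity. Values of \<open>\<pi>\<close> outside SU(3) and of \<open>\<rho>\<close> outside sl(3) are irrelevant.
\<close>

definition su3_unitary_rep ::
  "(complex^3^3 \<Rightarrow> complex^'m^'m) \<Rightarrow> (complex^3^3 \<Rightarrow> complex^'m^'m) \<Rightarrow> bool" where
  "su3_unitary_rep \<pi> \<rho> \<longleftrightarrow>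
     (\<forall>g\<in>SU3. adj (\<pi> g) ** \<pi> g = mat 1) \<and>
     (\<forall>g\<in>SU3. \<forall>h\<in>SU3. \<pi> (g ** h) = \<pi> g ** \<pi> h) \<and>
     continuous_on SU3 \<pi> \<and>
     (\<forall>X\<in>sl3. \<forall>Y\<in>sl3. \<rho> (X + Y) = \<rho> X + \<rho> Y) \<and>
     (\<forall>c. \<forall>X\<in>sl3. \<rho> (cscale c X) = cscale c (\<rho> X)) \<and>
     (\<forall>X\<in>sl3. \<forall>Y\<in>sl3. \<rho> (commutator X Y) = commutator (\<rho> X) (\<rho> Y)) \<and>
     (\<forall>c X. (\<forall>s::real. c s \<in> SU3) \<and> c 0 = mat 1 \<and> (c has_vector_derivative X) (at 0)
        \<longrightarrow> ((\<lambda>s. \<pi> (c s)) has_vector_derivative \<rho> X) (at 0))"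

definition E_unit :: "3 \<Rightarrow> 3 \<Rightarrow> complex^3^3" where
  "E_unit i j = (\<chi> k l. if k = i \<and> l = j then 1 else 0)"

definition T_plus :: "(complex^3^3 \<Rightarrow> complex^'m^'m) \<Rightarrow> complex^'m^'m" where
  "T_plus \<rho> = \<rho> (E_unit 1 2)"

definition T_minus :: "(complex^3^3 \<Rightarrow> complex^'m^'m) \<Rightarrow> complex^'m^'m" where
  "T_minus \<rho> = \<rho> (E_unit 2 1)"

definition T_three :: "(complex^3^3 \<Rightarrow> complex^'m^'m) \<Rightarrow> complex^'m^'m" where
  "T_three \<rho> = \<rho> (cscale (1/2) (E_unit 1 1 - E_unit 2 2))"

definition U_plus :: "(complex^3^3 \<Rightarrow> complex^'m^'m) \<Rightarrow> complex^'m^'m" where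
  "U_plus \<rho> = \<rho> (E_unit 2 3)"

definition U_minus :: "(complex^3^3 \<Rightarrow> complex^'m^'m) \<Rightarrow> complex^'m^'m" where
  "U_minus \<rho> = \<rho> (E_unit 3 2)"

definition U_three :: "(complex^3^3 \<Rightarrow> complex^'m^'m) \<Rightarrow> complex^'m^'m" where
  "U_three \<rho> = \<rho> (cscale (1/2) (E_unit 2 2 - E_unit 3 3))"

definition invariant_subspace ::
  "(complex^3^3 \<Rightarrow> complex^'m^'m) \<Rightarrow> (complex^'m) set \<Rightarrow> bool" where
  "invariant_subspace \<pi> V \<longleftrightarrow> vec.subspace V \<and> (\<forall>g\<in>SU3. \<forall>v\<in>V. \<pi> g *v v \<in> V)"

definition irreducible_subspace ::
  "(complex^3^3 \<Rightarrow> complex^'m^'m) \<Rightarrow> (complex^'m) set \<Rightarrow> bool" where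
  "irreducible_subspace \<pi> V \<longleftrightarrow> invariant_subspace \<pi> V \<and> V \<noteq> {0} \<and>
     (\<forall>W. invariant_subspace \<pi> W \<and> W \<subseteq> V \<longrightarrow> W = {0} \<or> W = V)"

definition highest_weight_vector ::
  "(complex^3^3 \<Rightarrow> complex^'m^'m) \<Rightarrow> nat \<times> nat \<Rightarrow> complex^'m \<Rightarrow> bool" where
  "highest_weight_vector \<rho> p v \<longleftrightarrow> v \<noteq> 0 \<and>
     T_plus \<rho> *v v = 0 \<and> U_plus \<rho> *v v = 0 \<and>
     T_three \<rho> *v v = (of_nat (fst p) / 2) *s v \<and>
     U_three \<rho> *v v = (of_nat (snd p) / 2) *s v"

definition irrep_of_class ::
  "(complex^3^3 \<Rightarrow> complex^'m^'m) \<Rightarrow> (complex^3^3 \<Rightarrow> complex^'m^'m) \<Rightarrow>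
   (complex^'m) set \<Rightarrow> nat \<times> nat \<Rightarrow> bool" where
  "irrep_of_class \<pi> \<rho> V p \<longleftrightarrow>
     irreducible_subspace \<pi> V \<and> (\<exists>v\<in>V. highest_weight_vector \<rho> p v)"


section \<open>Gelfand-Tsetlin bases\<close>

type_synonym weight = "int \<times> int \<times> int"

definition size_of :: "nat \<times> nat \<Rightarrow> int" where
  "size_of p = int (fst p + snd p)"

fun nu1 :: "weight \<Rightarrow> int" where "nu1 (n1, n2, n3) = n1"
fun nu2 :: "weight \<Rightarrow> int" where "nu2 (n1, n2, n3) = n2"
fun nu3 :: "weight \<Rightarrow> int" where "nu3 (n1, n2, n3) = n3"

definition t_of :: "weight \<Rightarrow> real" where
  "t_of \<nu> = of_int (nu1 \<nu> - nu2 \<nu>) / 2"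

definition u_of :: "weight \<Rightarrow> real" where
  "u_of \<nu> = of_int (nu2 \<nu> - nu3 \<nu>) / 2"

text \<open>The exponent \<open>2 (t\<^sub>\<nu> + u\<^sub>\<nu>)\<close>, which is the integer \<open>\<nu>\<^sub>1 - \<nu>\<^sub>3\<close>.\<close>

definition two_tu :: "weight \<Rightarrow> int" where
  "two_tu \<nu> = nu1 \<nu> - nu3 \<nu>"

definition gt_labels :: "nat \<times> nat \<Rightarrow> (weight \<times> real) set" where
  "gt_labels p = {((int (fst p) + 2 * int (snd p) - (rp + rm), rp + rm - n3, n3),
                   of_int (rp - rm) / 2) | rm rp n3.
      0 \<le> rm \<and> rm \<le> int (snd p) \<and> int (snd p) \<le> rp \<and> rp \<le> int (fst p) + int (snd p) \<and>
      rm \<le> n3 \<and> n3 \<le> rp}"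

text \<open>
  In the lowering formulas the target label may fall outside \<^const>\<open>gt_labels\<close>; this happens
  exactly when the numerator of the coefficient vanishes, so the value of \<open>e\<close> there does not
  matter (and the division by \<open>J = 0\<close> occurs only with vanishing numerator).
\<close>

definition gt_basis ::
  "(complex^3^3 \<Rightarrow> complex^'m^'m) \<Rightarrow> (complex^'m) set \<Rightarrow> nat \<times> nat \<Rightarrow>
   (weight \<Rightarrow> real \<Rightarrow> complex^'m) \<Rightarrow> bool" where
  "gt_basis \<rho> V a e \<longleftrightarrow>
     (\<forall>(\<nu>, J)\<in>gt_labels a. \<forall>(\<nu>', J')\<in>gt_labels a.
        cinner (e \<nu> J) (e \<nu>' J') = (if (\<nu>, J) = (\<nu>', J') then 1 else 0)) \<and>
     vec.span {e \<nu> J | \<nu> J. (\<nu>, J) \<in> gt_labels a} = V \<and>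
     (let p = int (fst a); q = int (snd a) in
       highest_weight_vector \<rho> a (e (p + q, q, 0) (of_int q / 2)) \<and>
       (\<forall>n1 n2 n3 J. ((n1, n2, n3), J) \<in> gt_labels a \<longrightarrow>
         (let u = u_of (n1, n2, n3); P = real_of_int p; Q = real_of_int q; N = real_of_int n3 in
           U_minus \<rho> *v e (n1, n2, n3) J =
             complex_of_real (sqrt ((J + u) * (J - u + 1))) *s e (n1, n2 - 1, n3 + 1) J \<and>
           T_minus \<rho> *v e (n1, n2, n3) J =
             complex_of_real (sqrt ((J - u) * (P + Q + J - u - N + 1) * (Q + J - u - N) * (u - J + N + 1)
                 / (2 * J * (2 * J + 1)))) *s e (n1 - 1, n2 + 1, n3) (J - 1/2) +
             complex_of_real (sqrt ((J + u + 1) * (P + Q - J - u - N) * (J + u + 1 + N - Q) * (J + u + 2 + N)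
                 / (2 * (J + 1) * (2 * J + 1)))) *s e (n1 - 1, n2 + 1, n3) (J + 1/2))))"

definition check_weight :: "int \<Rightarrow> weight \<Rightarrow> weight" where
  "check_weight s \<nu> = (s - nu1 \<nu>, s - nu2 \<nu>, s - nu3 \<nu>)"


section \<open>The representation on operators, as a tensor product\<close>

text \<open>
  The dual space of \<^typ>\<open>complex^'n\<close> is coordinatised by the dual of the standard basis:
  \<open>f :: complex^'n\<close> stands for the functional \<open>x \<mapsto> (\<Sum>k. f $ k * x $ k)\<close>, so the functional
  \<open>v\<^sup>*\<close> given by \<open>x \<mapsto> cinner v x\<close> has the conjugate coordinates. The tensor product of
  \<^typ>\<open>complex^'n\<close> with its dual is \<^typ>\<open>complex^('n \<times> 'n)\<close>, and \<open>to_op\<close> is its identification with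
  the operators, sending \<open>x \<otimes> f\<close> to the operator \<open>y \<mapsto> f y x\<close>.
\<close>

definition dual_vec :: "complex^'n \<Rightarrow> complex^'n" where
  "dual_vec v = (\<chi> k. cnj (v $ k))"

definition tensor_vec :: "complex^'n \<Rightarrow> complex^'k \<Rightarrow> complex^('n \<times> 'k)" where
  "tensor_vec x y = (\<chi> ij. x $ fst ij * y $ snd ij)"

definition tensor_mat :: "complex^'n^'n \<Rightarrow> complex^'k^'k \<Rightarrow> complex^('n \<times> 'k)^('n \<times> 'k)" where
  "tensor_mat A B = (\<chi> ij kl. A $ fst ij $ fst kl * B $ snd ij $ snd kl)"

definition to_op :: "complex^('n \<times> 'n) \<Rightarrow> complex^'n^'n" where
  "to_op w = (\<chi> i k. w $ (i, k))"

definition tensor_dual_grp ::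
  "(complex^3^3 \<Rightarrow> complex^'n^'n) \<Rightarrow> complex^3^3 \<Rightarrow> complex^('n \<times> 'n)^('n \<times> 'n)" where
  "tensor_dual_grp \<pi> g = tensor_mat (\<pi> g) (transpose (matrix_inv (\<pi> g)))"

definition tensor_dual_alg ::
  "(complex^3^3 \<Rightarrow> complex^'n^'n) \<Rightarrow> complex^3^3 \<Rightarrow> complex^('n \<times> 'n)^('n \<times> 'n)" where
  "tensor_dual_alg \<rho> X =
     tensor_mat (\<rho> X) (mat 1) + tensor_mat (mat 1) (- transpose (\<rho> X))"

text \<open>
  \<open>induced_dual_basis p e\<close> is the basis induced on the dual of the irrep \<open>p\<close>, indexed by the labels
  of the dual irrep \<open>(q, p)\<close>; its value at \<open>\<nu>\<close> comes from \<open>e\<close> at the label with check \<open>\<nu>\<close>, and the check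
  is involutive.
\<close>

definition induced_dual_basis ::
  "nat \<times> nat \<Rightarrow> (weight \<Rightarrow> real \<Rightarrow> complex^'n) \<Rightarrow> weight \<Rightarrow> real \<Rightarrow> complex^'n" where
  "induced_dual_basis p e \<nu> J =
     ((-1) powi two_tu (check_weight (size_of p) \<nu>)) *s
       dual_vec (e (check_weight (size_of p) \<nu>) J)"


section \<open>Coupled bases and the Wigner product symbol\<close>

type_synonym irrep_index = "(nat \<times> nat) \<times> nat"

text \<open>
  A decomposition into irreps is indexed by pairs \<open>(a, \<sigma>)\<close>, with \<open>m a\<close> the number of its members
  of class \<open>a\<close>, that is, the multiplicity of \<open>a\<close>.
\<close>

definition cg_series :: "(nat \<times> nat \<Rightarrow> nat) \<Rightarrow> irrep_index set" where
  "cg_series m = {(a, \<sigma>). 1 \<le> \<sigma> \<and> \<sigma> \<le> m a}"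

definition orthogonal_irrep_decomposition ::
  "(complex^3^3 \<Rightarrow> complex^'m^'m) \<Rightarrow> (complex^3^3 \<Rightarrow> complex^'m^'m) \<Rightarrow>
   (nat \<times> nat \<Rightarrow> nat) \<Rightarrow> (irrep_index \<Rightarrow> (complex^'m) set) \<Rightarrow> bool" where
  "orthogonal_irrep_decomposition \<pi> \<rho> m W \<longleftrightarrow>
     finite (cg_series m) \<and>
     (\<forall>k\<in>cg_series m. irrep_of_class \<pi> \<rho> (W k) (fst k)) \<and>
     (\<forall>k\<in>cg_series m. \<forall>l\<in>cg_series m. k \<noteq> l \<longrightarrow> (\<forall>v\<in>W k. \<forall>w\<in>W l. cinner v w = 0)) \<and>
     vec.span (\<Union>k\<in>cg_series m. W k) = UNIV"

definition cg_coeff ::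
  "nat \<times> nat \<Rightarrow> (weight \<Rightarrow> real \<Rightarrow> complex^'n) \<Rightarrow>
   (irrep_index \<Rightarrow> weight \<Rightarrow> real \<Rightarrow> complex^('n \<times> 'n)) \<Rightarrow> irrep_index \<Rightarrow>
   weight \<Rightarrow> real \<Rightarrow> weight \<Rightarrow> real \<Rightarrow> weight \<Rightarrow> real \<Rightarrow> complex" where
  "cg_coeff p e E k \<nu>1 J1 \<nu>2 J2 \<nu> J =
     cinner (E k \<nu> J) (tensor_vec (e \<nu>1 J1) (induced_dual_basis p e \<nu>2 J2))"

definition coupled_basis ::
  "(complex^3^3 \<Rightarrow> complex^'n^'n) \<Rightarrow> (complex^3^3 \<Rightarrow> complex^'n^'n) \<Rightarrow> nat \<times> nat \<Rightarrow>
   (weight \<Rightarrow> real \<Rightarrow> complex^'n) \<Rightarrow> (nat \<times> nat \<Rightarrow> nat) \<Rightarrow>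
   (irrep_index \<Rightarrow> weight \<Rightarrow> real \<Rightarrow> complex^('n \<times> 'n)) \<Rightarrow> bool" where
  "coupled_basis \<pi> \<rho> p e m E \<longleftrightarrow>
     (\<exists>W. orthogonal_irrep_decomposition (tensor_dual_grp \<pi>) (tensor_dual_alg \<rho>) m W \<and>
       (\<forall>k\<in>cg_series m. gt_basis (tensor_dual_alg \<rho>) (W k) (fst k) (E k))) \<and>
     (\<forall>k\<in>cg_series m. \<forall>(\<nu>, J)\<in>gt_labels (fst k).
       \<forall>(\<nu>1, J1)\<in>gt_labels p. \<forall>(\<nu>2, J2)\<in>gt_labels (prod.swap p).
         cg_coeff p e E k \<nu>1 J1 \<nu>2 J2 \<nu> J \<in> \<real>)"

definition wigner_symbol ::
  "nat \<times> nat \<Rightarrow> (weight \<Rightarrow> real \<Rightarrow> complex^'n) \<Rightarrow>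
   (irrep_index \<Rightarrow> weight \<Rightarrow> real \<Rightarrow> complex^('n \<times> 'n)) \<Rightarrow>
   irrep_index \<Rightarrow> irrep_index \<Rightarrow> irrep_index \<Rightarrow>
   weight \<Rightarrow> real \<Rightarrow> weight \<Rightarrow> real \<Rightarrow> weight \<Rightarrow> real \<Rightarrow> complex" where
  "wigner_symbol p e E k1 k2 k \<nu>1 J1 \<nu>2 J2 \<nu> J =
     (\<Sum>(\<mu>1, I1)\<in>gt_labels p. \<Sum>(\<mu>2, I2)\<in>gt_labels (prod.swap p). \<Sum>(\<mu>3, I3)\<in>gt_labels (prod.swap p).
        (-1) powi (size_of p + two_tu \<nu> + two_tu \<mu>2) *
        cg_coeff p e E k1 \<mu>1 I1 \<mu>2 I2 \<nu>1 J1 *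
        cg_coeff p e E k2 (check_weight (size_of p) \<mu>2) I2 \<mu>3 I3 \<nu>2 J2 *
        cg_coeff p e E k \<mu>1 I1 \<mu>3 I3 (check_weight (size_of (fst k)) \<nu>) J)"

definition delta :: "real \<Rightarrow> real \<Rightarrow> real \<Rightarrow> nat" where
  "delta x y z =
     (if x \<le> y + z \<and> y \<le> x + z \<and> z \<le> x + y \<and> x + y + z \<in> \<int> then 1 else 0)"

end

theory Submission
  imports Defs
begin

text \<open>
  A coupled basis is orthonormal for the Hilbert-Schmidt product, so the coefficients of the operator
  product \<open>A B\<close> are \<open>tr (F\<^sup>* A B)\<close>, with \<open>F\<close> running over the basis. Writing this trace in the
  Gelfand-Tsetlin basis of \<open>p\<close> gives a triple sum of products of matrix elements, which are signed
  (real) Clebsch-Gordan coefficients; the signs cancel against those of the Wigner symbol.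

  The operators \<open>T\<^sub>3\<close> and \<open>U\<^sub>3\<close> act on operators as derivations and are diagonal in the coupled basis,
  which gives the two weight conditions. For the triangle inequality, let \<open>D\<close> be the derivation given
  by \<open>U\<^sub>-\<close>. By unitarity \<open>U\<^sub>+\<close> is the adjoint of \<open>U\<^sub>-\<close>, so \<open>F\<^sup>*\<close> has the spin of \<open>F\<close> and the
  opposite weight. If \<open>X, Y, Z\<close> have spins \<open>j\<^sub>1, j\<^sub>2, j\<^sub>3\<close> and weights adding up to zero, then
  \<open>D\<close> to the power \<open>j\<^sub>2 + j\<^sub>3 - u\<^sub>1 + 1\<close> annihilates \<open>Y Z\<close> by the Leibniz rule, whereas \<open>X\<close> lies in the
  image of \<open>D\<close> to the power \<open>j\<^sub>1 - u\<^sub>1\<close>. Moving \<open>D\<close> across the trace shows \<open>tr (X Y Z) = 0\<close> unless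
  \<open>j\<^sub>1 \<le> j\<^sub>2 + j\<^sub>3\<close>. Cyclicity of the trace gives the other two inequalities.
\<close>

section \<open>Orthonormal bases and the Hilbert-Schmidt product\<close>

lemma cinner_commute: "cnj (cinner v w) = cinner w v"
  by (simp add: cinner_def mult.commute)

lemma cinner_add_right: "cinner v (w + x) = cinner v w + cinner v x"
  by (simp add: cinner_def distrib_left sum.distrib)

lemma cinner_scale_right: "cinner v (c *s w) = c * cinner v w"
  by (simp add: cinner_def sum_distrib_left algebra_simps)

lemma cinner_scale_left: "cinner (c *s v) w = cnj c * cinner v w"
  by (simp add: cinner_def sum_distrib_left algebra_simps)

lemma cinner_zero_right: "cinner v 0 = 0"
  by (simp add: cinner_def)

lemma cinner_sum_right: "cinner v (sum f A) = (\<Sum>i\<in>A. cinner v (f i))"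
  by (induction A rule: infinite_finite_induct) (simp_all add: cinner_zero_right cinner_add_right)

lemma adj_adj: "adj (adj A) = A"
  by (simp add: adj_def vec_eq_iff)

lemma adj_mult: "adj (A ** B) = adj B ** adj A"
  by (simp add: adj_def vec_eq_iff matrix_matrix_mult_def mult.commute)

lemma adj_diff: "adj (A - B) = adj A - adj B"
  by (simp add: adj_def vec_eq_iff)

lemma cinner_adj: "cinner v (A *v w) = cinner (adj A *v v) w"
proof -
  have "cinner v (A *v w) = (\<Sum>i\<in>UNIV. \<Sum>j\<in>UNIV. cnj (v $ i) * (A $ i $ j * w $ j))"
    by (simp add: cinner_def matrix_vector_mult_def sum_distrib_left)
  also have "\<dots> = (\<Sum>j\<in>UNIV. \<Sum>i\<in>UNIV. cnj (v $ i) * (A $ i $ j * w $ j))"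
    by (rule sum.swap)
  also have "\<dots> = cinner (adj A *v v) w"
    by (simp add: cinner_def matrix_vector_mult_def adj_def sum_distrib_right sum_distrib_left mult_ac)
  finally show ?thesis .
qed

section \<open>Orthonormal bases indexed by labels: expansion, Parseval identity and trace\<close>

definition orthonormal_basis :: "'i set \<Rightarrow> ('i \<Rightarrow> complex^'m) \<Rightarrow> bool" where
  "orthonormal_basis I b \<longleftrightarrow> finite I \<and>
     (\<forall>i\<in>I. \<forall>j\<in>I. cinner (b i) (b j) = (if i = j then 1 else 0)) \<and>
     vec.span (b ` I) = UNIV"

text \<open>The vectors equal to their own expansion form a subspace; by orthonormality it contains
  the basis, hence its span.\<close>

lemma orthonormal_basis_expansion:
  assumes "orthonormal_basis I b"
  shows "v = (\<Sum>i\<in>I. cinner (b i) v *s b i)"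
proof -
  let ?g = "\<lambda>v. \<Sum>i\<in>I. cinner (b i) v *s b i"
  have fin: "finite I" and on: "\<And>i j. i \<in> I \<Longrightarrow> j \<in> I \<Longrightarrow> cinner (b i) (b j) = (if i = j then 1 else 0)"
    and "v \<in> vec.span (b ` I)"
    using assms by (auto simp: orthonormal_basis_def)
  from this(3) show "v = ?g v"
  proof (rule vec.span_induct[where P = "\<lambda>v. v = ?g v"])
    show "vec.subspace {v. v = ?g v}"
      unfolding vec.subspace_def
    proof (intro conjI ballI allI)
      show "0 \<in> {v. v = ?g v}" by (simp add: cinner_zero_right)
      show "x + y \<in> {v. v = ?g v}" if "x \<in> {v. v = ?g v}" "y \<in> {v. v = ?g v}" for x y
      proof -
        have "?g (x + y) = ?g x + ?g y"
          by (simp add: cinner_add_right vector_sadd_rdistrib sum.distrib)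
        then show ?thesis using that by simp
      qed
      show "c *s x \<in> {v. v = ?g v}" if "x \<in> {v. v = ?g v}" for c x
      proof -
        have "?g (c *s x) = c *s ?g x"
          by (simp add: cinner_scale_right vec.scale_sum_right)
        then show ?thesis using that by simp
      qed
    qed
    fix x assume "x \<in> b ` I"
    then obtain j where j: "j \<in> I" "x = b j" by blast
    show "x = ?g x"
    proof -
      have "?g x = (\<Sum>i\<in>I. if i = j then b i else 0)"
        using j on by (intro sum.cong) auto
      then show ?thesis using j fin by simp
    qed
  qed
qed

lemma orthonormal_basis_parseval:
  assumes "orthonormal_basis I b"
  shows "cinner v w = (\<Sum>i\<in>I. cinner v (b i) * cinner (b i) w)"
proof -
  have "cinner v w = cinner v (\<Sum>i\<in>I. cinner (b i) w *s b i)"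
    using orthonormal_basis_expansion[OF assms, of w] by simp
  then show ?thesis by (simp add: cinner_sum_right cinner_scale_right mult.commute)
qed

text \<open>Start from the trace in the standard basis, insert the Parseval identity for
  \<open>b\<close>, and exchange the sums; the standard basis then recombines into an inner
  product.\<close>

lemma orthonormal_basis_trace:
  fixes M :: "complex^'m^'m"
  assumes "orthonormal_basis I b"
  shows "trace M = (\<Sum>i\<in>I. cinner (b i) (M *v b i))"
proof -
  have ax: "cinner v (axis j 1) = cnj (v $ j)" for v :: "complex^'m" and j
    by (simp add: cinner_def axis_def if_distrib cong: if_cong)
  have ax': "cinner (axis j 1) v = v $ j" for v :: "complex^'m" and j
    using ax[of v j] cinner_commute[of v "axis j 1"] by simp
  have "trace M = (\<Sum>j\<in>UNIV. cinner (axis j 1) (M *v axis j 1))"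
    unfolding ax' by (simp add: trace_def matrix_vector_mult_def axis_def if_distrib cong: if_cong)
  also have "\<dots> = (\<Sum>j\<in>UNIV. \<Sum>i\<in>I. b i $ j * cnj ((adj M *v b i) $ j))"
    by (subst orthonormal_basis_parseval[OF assms]) (simp only: cinner_adj ax ax')
  also have "\<dots> = (\<Sum>i\<in>I. \<Sum>j\<in>UNIV. cnj ((adj M *v b i) $ j) * b i $ j)"
    by (subst sum.swap) (simp add: mult.commute)
  also have "\<dots> = (\<Sum>i\<in>I. cinner (b i) (M *v b i))"
    by (simp only: cinner_adj[of _ M]) (simp only: cinner_def)
  finally show ?thesis .
qed

section \<open>Tensors as operators with the Hilbert-Schmidt product\<close>

lemma cinner_to_op: "cinner v w = trace (adj (to_op v) ** to_op w)"
proof -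
  have "cinner v w = (\<Sum>i\<in>UNIV. \<Sum>j\<in>UNIV. cnj (v $ (i, j)) * w $ (i, j))"
    unfolding cinner_def UNIV_Times_UNIV[symmetric] sum.cartesian_product by simp
  also have "\<dots> = (\<Sum>j\<in>UNIV. \<Sum>i\<in>UNIV. cnj (v $ (i, j)) * w $ (i, j))"
    by (rule sum.swap)
  finally show ?thesis
    by (simp add: trace_def adj_def to_op_def matrix_matrix_mult_def)
qed

lemma to_op_inject: "to_op v = to_op w \<longleftrightarrow> v = w"
  by (auto simp: to_op_def vec_eq_iff)

lemma to_op_surj: "\<exists>v. to_op v = A"
  by (rule exI[of _ "\<chi> ij. A $ fst ij $ snd ij"]) (simp add: to_op_def vec_eq_iff)

lemma to_op_add: "to_op (v + w) = to_op v + to_op w"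
  by (simp add: to_op_def vec_eq_iff)

lemma to_op_scale: "to_op (c *s v) = cscale c (to_op v)"
  by (simp add: to_op_def cscale_def vec_eq_iff)

lemma to_op_sum: "to_op (sum f A) = (\<Sum>i\<in>A. to_op (f i))"
  by (simp add: to_op_def vec_eq_iff)

text \<open>The first tensor factor acts by left multiplication. The dual factor acts by minus the
  transpose on the second index, which is right multiplication by \<open>- \<rho> X\<close>.\<close>

lemma to_op_tensor_dual_alg:
  "to_op (tensor_dual_alg \<rho> X *v w) = commutator (\<rho> X) (to_op w)"
proof -
  have "(tensor_dual_alg \<rho> X *v w) $ (i, k) = commutator (\<rho> X) (to_op w) $ i $ k" for i k
  proof -
    have "(tensor_dual_alg \<rho> X *v w) $ (i, k) =
       (\<Sum>j\<in>UNIV. \<Sum>l\<in>UNIV. (\<rho> X $ i $ j * (if k = l then 1 else 0)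
           - (if i = j then 1 else 0) * \<rho> X $ l $ k) * w $ (j, l))"
      unfolding matrix_vector_mult_def UNIV_Times_UNIV[symmetric] sum.cartesian_product
      by (simp add: tensor_dual_alg_def tensor_mat_def mat_def transpose_def case_prod_beta)
    also have "\<dots> = (\<Sum>j\<in>UNIV. \<Sum>l\<in>UNIV. if k = l then \<rho> X $ i $ j * w $ (j, l) else 0)
        - (\<Sum>j\<in>UNIV. \<Sum>l\<in>UNIV. if i = j then w $ (j, l) * \<rho> X $ l $ k else 0)"
      unfolding sum_subtractf[symmetric] by (intro sum.cong refl) (simp add: algebra_simps)
    also have "(\<Sum>j\<in>UNIV. \<Sum>l\<in>UNIV. if i = j then w $ (j, l) * \<rho> X $ l $ k else 0)
        = (\<Sum>l\<in>UNIV. \<Sum>j\<in>UNIV. if i = j then w $ (j, l) * \<rho> X $ l $ k else 0)"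
      by (rule sum.swap)
    also have "(\<Sum>j\<in>UNIV. \<Sum>l\<in>UNIV. if k = l then \<rho> X $ i $ j * w $ (j, l) else 0) - \<dots> =
       (\<Sum>j\<in>UNIV. \<rho> X $ i $ j * w $ (j, k)) - (\<Sum>l\<in>UNIV. w $ (i, l) * \<rho> X $ l $ k)"
      by simp
    finally show ?thesis
      by (simp add: commutator_def matrix_matrix_mult_def to_op_def)
  qed
  then show ?thesis by (simp add: vec_eq_iff to_op_def)
qed


section \<open>Unitarity and the adjoint of a root vector\<close>

text \<open>
  The velocities at \<open>0\<close> are \<open>E\<^sub>2\<^sub>3 - E\<^sub>3\<^sub>2\<close> (for \<open>z = 1\<close>) and
  \<open>\<i> (E\<^sub>2\<^sub>3 + E\<^sub>3\<^sub>2)\<close> (for \<open>z = \<i>\<close>), so that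
  these two curves determine the adjoints of the images of both root vectors.
\<close>

definition su2_curve :: "complex \<Rightarrow> real \<Rightarrow> complex^3^3" where
  "su2_curve z s = E_unit 1 1 + cos s *\<^sub>R (E_unit 2 2 + E_unit 3 3)
     + sin s *\<^sub>R (cscale z (E_unit 2 3) - cscale (cnj z) (E_unit 3 2))"

lemma su2_curve_SU3:
  assumes "norm z = 1"
  shows "su2_curve z s \<in> SU3"
proof -
  define c d where "c = complex_of_real (cos s)" and "d = complex_of_real (sin s)"
  have z: "z * cnj z = 1"
    using assms by (simp add: complex_norm_square[symmetric])
  have cd: "c * c + d * d = 1"
    unfolding c_def d_def by (metis of_real_add of_real_mult of_real_1 sin_cos_squared_add3)
  have cnj: "cnj c = c" "cnj d = d" by (simp_all add: c_def d_def)
  have entries: "su2_curve z s = (\<chi> i j. if i = 1 \<and> j = 1 then 1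
      else if i = 2 \<and> j = 2 \<or> i = 3 \<and> j = 3 then c
      else if i = 2 \<and> j = 3 then d * z
      else if i = 3 \<and> j = 2 then - d * cnj z else 0)"
    unfolding su2_curve_def E_unit_def cscale_def vec_eq_iff forall_3
    by (simp add: c_def d_def) (simp add: scaleR_conv_of_real)
  have "c * c + d * cnj z * (d * z) = 1" "d * z * (d * cnj z) + c * c = 1"
    using z cd by algebra+
  then have "adj (su2_curve z s) ** su2_curve z s = mat 1" "det (su2_curve z s) = 1"
    unfolding entries
    by (simp_all add: adj_def matrix_matrix_mult_def mat_def vec_eq_iff forall_3 sum_3 det_3 cnj mult_ac)
  then show ?thesis by (simp add: SU3_def)
qed

lemma su2_curve_deriv:
  "(su2_curve z has_vector_derivative (cscale z (E_unit 2 3) - cscale (cnj z) (E_unit 3 2))) (at 0)"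
  unfolding su2_curve_def
  by (auto intro!: derivative_eq_intros)

text \<open>The image of the identity is idempotent; multiplying by its adjoint, which is a left
  inverse, cancels one factor.\<close>

lemma su3_unitary_rep_one:
  assumes "su3_unitary_rep \<pi> \<rho>"
  shows "\<pi> (mat 1) = mat 1"
proof -
  have m1: "mat 1 \<in> SU3"
    by (simp add: SU3_def adj_def mat_def vec_eq_iff matrix_matrix_mult_def forall_3 sum_3 det_3)
  have "adj (\<pi> (mat 1)) ** \<pi> (mat 1) = mat 1" "\<pi> (mat 1 ** mat 1) = \<pi> (mat 1) ** \<pi> (mat 1)"
    using assms m1 by (auto simp: su3_unitary_rep_def)
  then show ?thesis by (metis matrix_mul_assoc matrix_mul_lid)
qed

text \<open>Differentiate the constant \<open>adj (\<pi> (c s)) ** \<pi> (c s)\<close> at 0, entry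
  by entry, using that \<open>\<pi> (c 0)\<close> is the identity.\<close>

lemma su3_unitary_rep_skew:
  assumes rep: "su3_unitary_rep \<pi> \<rho>"
    and c: "\<And>s. c s \<in> SU3" "c 0 = mat 1" "(c has_vector_derivative X) (at 0)"
  shows "adj (\<rho> X) = - \<rho> X"
proof -
  have "((\<lambda>s. \<pi> (c s)) has_vector_derivative \<rho> X) (at 0)"
    using rep c unfolding su3_unitary_rep_def by blast
  then have d: "((\<lambda>s. \<pi> (c s) $ i $ j) has_vector_derivative \<rho> X $ i $ j) (at 0)" for i j
    by (intro bounded_linear.has_vector_derivative[OF bounded_linear_vec_nth])
  have "adj (\<rho> X) $ i $ j + \<rho> X $ i $ j = 0" for i j
  proof -
    let ?g = "\<lambda>s. \<Sum>k\<in>UNIV. cnj (\<pi> (c s) $ k $ i) * \<pi> (c s) $ k $ j"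
    have "?g s = mat 1 $ i $ j" for s
    proof -
      have "adj (\<pi> (c s)) ** \<pi> (c s) = mat 1"
        using rep c(1) by (auto simp: su3_unitary_rep_def)
      then have "(adj (\<pi> (c s)) ** \<pi> (c s)) $ i $ j = mat 1 $ i $ j" by simp
      then show ?thesis by (simp add: adj_def matrix_matrix_mult_def)
    qed
    then have "(?g has_vector_derivative 0) (at 0)" by simp
    moreover have "(?g has_vector_derivative (\<Sum>k\<in>UNIV. cnj (\<pi> (c 0) $ k $ i) * \<rho> X $ k $ j
        + cnj (\<rho> X $ k $ i) * \<pi> (c 0) $ k $ j)) (at 0)"
      by (intro has_vector_derivative_sum has_vector_derivative_mult d
          bounded_linear.has_vector_derivative[OF bounded_linear_cnj])
    ultimately have "(\<Sum>k\<in>UNIV. cnj (\<pi> (c 0) $ k $ i) * \<rho> X $ k $ j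
        + cnj (\<rho> X $ k $ i) * \<pi> (c 0) $ k $ j) = 0"
      by (rule vector_derivative_unique_at[symmetric])
    then show ?thesis
      using su3_unitary_rep_one[OF rep] c(2)
      by (simp add: mat_def sum.distrib if_distrib if_distribR adj_def add.commute cong: if_cong)
  qed
  then show ?thesis by (simp add: vec_eq_iff eq_neg_iff_add_eq_0)
qed

lemma sl3_off_diagonal: "i \<noteq> j \<Longrightarrow> E_unit i j \<in> sl3"
  by (auto simp: sl3_def trace_def E_unit_def intro!: sum.neutral)

lemma sl3_cscale: "X \<in> sl3 \<Longrightarrow> cscale c X \<in> sl3"
  by (simp add: sl3_def trace_def cscale_def sum_distrib_left[symmetric])

text \<open>Root vectors are not tangent to SU(3), so skewness is applied to two combinations of
  \<open>?a\<close> and \<open>?b\<close>. Writing * for the adjoint, z = 1 gives a* - b* = b - a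
  and z = i gives a* + b* = b + a; subtracting leaves b* = a.\<close>

lemma adj_U_minus:
  assumes rep: "su3_unitary_rep \<pi> \<rho>"
  shows "adj (U_minus \<rho>) = U_plus \<rho>"
proof -
  let ?a = "\<rho> (E_unit 2 3)" and ?b = "\<rho> (E_unit 3 2)"
  have lin: "\<rho> (cscale z (E_unit 2 3) - cscale (cnj z) (E_unit 3 2)) = cscale z ?a - cscale (cnj z) ?b" for z
  proof -
    have "cscale z (E_unit 2 3) - cscale (cnj z) (E_unit 3 2) = cscale z (E_unit 2 3) + cscale (- cnj z) (E_unit 3 2)"
      by (simp add: cscale_def vec_eq_iff)
    moreover have "(2::3) \<noteq> 3" "(3::3) \<noteq> 2" by simp_all
    ultimately have "\<rho> (cscale z (E_unit 2 3) - cscale (cnj z) (E_unit 3 2)) = cscale z ?a + cscale (- cnj z) ?b"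
      using rep unfolding su3_unitary_rep_def by (metis sl3_off_diagonal sl3_cscale)
    then show ?thesis by (simp add: cscale_def vec_eq_iff)
  qed
  have sk: "adj (cscale z ?a - cscale (cnj z) ?b) = - (cscale z ?a - cscale (cnj z) ?b)" if "norm z = 1" for z
  proof -
    have "su2_curve z 0 = mat 1"
      by (simp add: su2_curve_def vec_eq_iff forall_3 E_unit_def mat_def)
    then show ?thesis
      using su3_unitary_rep_skew[OF rep su2_curve_SU3[OF that] _ su2_curve_deriv] lin by simp
  qed
  have "cnj (?b $ j $ i) = ?a $ i $ j" for i j
  proof -
    have 1: "cnj (?a $ j $ i) - cnj (?b $ j $ i) = ?b $ i $ j - ?a $ i $ j"
      using arg_cong[OF sk[of 1], of "\<lambda>M. M $ i $ j"] by (simp add: adj_def cscale_def)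
    have "- \<i> * cnj (?a $ j $ i) - \<i> * cnj (?b $ j $ i) = - \<i> * ?b $ i $ j - \<i> * ?a $ i $ j"
      using arg_cong[OF sk[of \<i>], of "\<lambda>M. M $ i $ j"] by (simp add: adj_def cscale_def)
    then have "\<i> * (cnj (?a $ j $ i) + cnj (?b $ j $ i)) = \<i> * (?b $ i $ j + ?a $ i $ j)"
      by (simp add: algebra_simps)
    then have "cnj (?a $ j $ i) + cnj (?b $ j $ i) = ?b $ i $ j + ?a $ i $ j" by simp
    with 1 show ?thesis by algebra
  qed
  then show ?thesis by (simp add: adj_def vec_eq_iff U_minus_def U_plus_def)
qed


section \<open>Ladders of a derivation\<close>

lemma cscale_cscale: "cscale a (cscale b A) = cscale (a * b) A"
  by (simp add: cscale_def vec_eq_iff)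

lemma cscale_one: "cscale 1 A = A"
  by (simp add: cscale_def vec_eq_iff)

lemma cscale_zero_left: "cscale 0 A = 0"
  by (simp add: cscale_def vec_eq_iff)

lemma cscale_zero_right: "cscale c 0 = 0"
  by (simp add: cscale_def vec_eq_iff)

lemma cscale_mult_left: "cscale c A ** B = cscale c (A ** B)"
  by (simp add: cscale_def vec_eq_iff matrix_matrix_mult_def sum_distrib_left mult_ac)

lemma cscale_mult_right: "A ** cscale c B = cscale c (A ** B)"
  by (simp add: cscale_def vec_eq_iff matrix_matrix_mult_def sum_distrib_left mult_ac)

lemma cscale_diff: "cscale c (A - B) = cscale c A - cscale c B"
  by (simp add: cscale_def vec_eq_iff right_diff_distrib)

lemma matrix_diff_ldistrib: "A ** (B - C) = A ** B - A ** (C :: complex^'m^'m)"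
  by (simp add: vec_eq_iff matrix_matrix_mult_def right_diff_distrib sum_subtractf)

lemma matrix_diff_rdistrib: "(B - C) ** A = B ** A - C ** (A :: complex^'m^'m)"
  by (simp add: vec_eq_iff matrix_matrix_mult_def left_diff_distrib sum_subtractf)

lemma commutator_cscale_left: "commutator (cscale c f) A = cscale c (commutator f A)"
  by (simp add: commutator_def cscale_mult_left cscale_mult_right cscale_diff)

lemma commutator_cscale_right: "commutator f (cscale c A) = cscale c (commutator f A)"
  by (simp add: commutator_def cscale_mult_left cscale_mult_right cscale_diff)

lemma commutator_add_right: "commutator f (A + B) = commutator f A + commutator f B"
  by (simp add: commutator_def vec_eq_iff matrix_matrix_mult_def distrib_left distrib_right sum.distrib)

lemma commutator_zero_right: "commutator f 0 = 0"
  by (simp add: commutator_def)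

lemma commutator_mult: "commutator f (A ** B) = commutator f A ** B + A ** commutator f B"
  by (simp add: commutator_def matrix_diff_ldistrib matrix_diff_rdistrib matrix_mul_assoc)

lemma commutator_Jacobi:
  "commutator (commutator A B) C = commutator A (commutator B C) - commutator B (commutator A C)"
  by (simp add: commutator_def matrix_diff_ldistrib matrix_diff_rdistrib matrix_mul_assoc)

lemma commutator_adj: "commutator f (adj A) = cscale (-1) (adj (commutator (adj f) A))"
  by (simp add: commutator_def adj_diff adj_mult adj_adj) (simp add: cscale_def vec_eq_iff)

text \<open>Integration by parts: a commutator has trace zero, and the commutator with
  \<open>f\<close> is a derivation.\<close>

lemma trace_commutator_mult: "trace (commutator f A ** B) = - trace (A ** commutator f B)"
proof -
  have "trace (f ** A ** B) = trace (A ** B ** f)"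
    by (metis trace_mul_sym matrix_mul_assoc)
  then show ?thesis
    by (simp add: commutator_def matrix_diff_ldistrib matrix_diff_rdistrib trace_sub matrix_mul_assoc)
qed

section \<open>Iterated commutators\<close>

lemma funpow_commutator_cscale:
  "(commutator f ^^ n) (cscale c A) = cscale c ((commutator f ^^ n) A)"
  by (induction n) (simp_all add: commutator_cscale_right)

lemma funpow_commutator_zero: "(commutator f ^^ n) 0 = 0"
  by (induction n) (simp_all add: commutator_zero_right)

lemma funpow_commutator_add:
  "(commutator f ^^ n) (A + B) = (commutator f ^^ n) A + (commutator f ^^ n) B"
  by (induction n) (simp_all add: commutator_add_right)

lemma funpow_commutator_adj:
  "(commutator f ^^ n) (adj A) = cscale ((-1) ^ n) (adj ((commutator (adj f) ^^ n) A))"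
  by (induction n) (simp_all add: cscale_one commutator_cscale_right commutator_adj cscale_cscale mult.commute)

lemma trace_funpow_commutator_mult:
  "trace ((commutator f ^^ n) A ** B) = (-1) ^ n * trace (A ** (commutator f ^^ n) B)"
proof (induction n arbitrary: B)
  case (Suc n)
  have "trace ((commutator f ^^ Suc n) A ** B) = - trace ((commutator f ^^ n) A ** commutator f B)"
    by (simp add: trace_commutator_mult)
  then show ?case by (simp add: Suc.IH funpow_swap1)
qed simp

text \<open>If \<open>n\<close> derivatives are distributed over the two factors, \<open>A\<close>
  receives at least \<open>a\<close> or \<open>B\<close> at least \<open>b\<close>. The induction
  applies one derivative at a time, lowering \<open>a\<close> in one term of the Leibniz rule and
  \<open>b\<close> in the other.\<close>

lemma funpow_commutator_mult_eq_0:
  assumes "(commutator f ^^ a) A = 0" "(commutator f ^^ b) B = 0" "a + b \<le> n + 1"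
  shows "(commutator f ^^ n) (A ** B) = 0"
  using assms
proof (induction n arbitrary: a b A B)
  case 0
  then have "a = 0 \<or> b = 0" by auto
  with 0 show ?case by auto
next
  case (Suc n)
  show ?case
  proof (cases "a = 0 \<or> b = 0")
    case True
    with Suc.prems have "A ** B = 0" by auto
    then show ?thesis by (simp only: funpow_commutator_zero)
  next
    case False
    then obtain a' b' where ab: "a = Suc a'" "b = Suc b'" by (metis not0_implies_Suc)
    have "(commutator f ^^ n) (commutator f A ** B) = 0"
      using Suc.prems ab by (intro Suc.IH[where a = a' and b = b]) (simp_all add: funpow_swap1)
    moreover have "(commutator f ^^ n) (A ** commutator f B) = 0"
      using Suc.prems ab by (intro Suc.IH[where a = a and b = b']) (simp_all add: funpow_swap1)
    ultimately show ?thesis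
      by (simp add: funpow_swap1 commutator_mult funpow_commutator_add)
  qed
qed

text \<open>
  \<open>A\<close> can be reached by \<open>m\<close> lowering steps and is annihilated by \<open>l + 1\<close> further ones. For a vector
  of spin \<open>J\<close> and weight \<open>u\<close> this holds with \<open>m = J - u\<close> and \<open>l = J + u\<close>.
\<close>

definition ladder_position ::
  "complex^'m^'m \<Rightarrow> nat \<Rightarrow> nat \<Rightarrow> complex^'m^'m \<Rightarrow> bool" where
  "ladder_position f m l A \<longleftrightarrow>
     (\<exists>B. A = (commutator f ^^ m) B) \<and> (commutator f ^^ (l + 1)) A = 0"

text \<open>The \<open>x i\<close> form a chain that stops after \<open>x d\<close>, because
  \<open>c d = 0\<close>. Dividing by the nonzero coefficients before that writes \<open>x m\<close>
  as an \<open>m\<close>-fold commutator of a multiple of \<open>x 0\<close>.\<close>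

lemma ladder_positionI:
  assumes step: "\<And>i. i \<le> d \<Longrightarrow> commutator f (x i) = cscale (c i) (x (Suc i))"
    and "c d = 0" and nz: "\<And>i. i < d \<Longrightarrow> c i \<noteq> 0" and "m + l = d"
  shows "ladder_position f m l (x m)"
proof -
  have "\<exists>B. x m = (commutator f ^^ m) B" if "m \<le> d" for m
    using that
  proof (induction m)
    case (Suc m)
    then obtain B where "x m = (commutator f ^^ m) B" by auto
    then have "x (Suc m) = (commutator f ^^ Suc m) (cscale (1 / c m) B)"
      using step[of m] nz[of m] Suc.prems
      by (simp add: funpow_commutator_cscale commutator_cscale_right cscale_cscale cscale_one)
    then show ?case by blast
  qed auto
  moreover have "(commutator f ^^ (l + 1)) (x m) = 0" if "m + l = d" for m l
    using that
  proof (induction l arbitrary: m)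
    case 0
    then show ?case using step[of m] assms(2) by (simp add: cscale_zero_left)
  next
    case (Suc l)
    have "(commutator f ^^ (Suc l + 1)) (x m) = cscale (c m) ((commutator f ^^ (l + 1)) (x (Suc m)))"
      using step[of m] Suc.prems
      by (simp add: funpow_swap1 funpow_commutator_cscale commutator_cscale_right)
    then show ?case using Suc.IH[of "Suc m"] Suc.prems by (simp add: cscale_zero_right)
  qed
  ultimately show ?thesis using assms(4) by (auto simp: ladder_position_def)
qed

text \<open>Adjunction exchanges the commutators with \<open>adj f\<close> and with \<open>f\<close>
  up to a sign, which affects neither images nor kernels.\<close>

lemma ladder_position_adj:
  assumes "ladder_position (adj f) m l A"
  shows "ladder_position f m l (adj A)"
proof -
  obtain B where "A = (commutator (adj f) ^^ m) B"
    using assms by (auto simp: ladder_position_def)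
  then have "adj A = (commutator f ^^ m) (cscale ((-1) ^ m) (adj B))"
    by (simp add: funpow_commutator_cscale funpow_commutator_adj cscale_cscale cscale_one flip: power_mult_distrib)
  moreover have "(commutator f ^^ (l + 1)) (adj A) = 0"
    using assms unfolding funpow_commutator_adj ladder_position_def
    by (simp add: adj_def cscale_def vec_eq_iff)
  ultimately show ?thesis by (auto simp: ladder_position_def)
qed

lemma trace_ladder_positions:
  assumes "ladder_position f m1 l1 A" "ladder_position f m2 l2 B" "ladder_position f m3 l3 C"
    and "trace (A ** (B ** C)) \<noteq> 0"
  shows "m1 \<le> l2 + l3"
proof (rule ccontr)
  assume *: "\<not> m1 \<le> l2 + l3"
  obtain D where D: "A = (commutator f ^^ m1) D"
    using assms(1) by (auto simp: ladder_position_def)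
  \<comment> \<open>The Leibniz bound (l2 + 1) + (l3 + 1) \<le> m1 + 1 says exactly that m1 exceeds
    l2 + l3.\<close>
  have "(commutator f ^^ m1) (B ** C) = 0"
    using assms(2,3) * by (intro funpow_commutator_mult_eq_0[where a = "l2 + 1" and b = "l3 + 1"]) (auto simp: ladder_position_def)
  then show False using assms(4) unfolding D trace_funpow_commutator_mult
    by (simp add: trace_def)
qed

text \<open>\<open>A\<close> is a weighted shift of the basis, and its adjoint is read off from the
  conjugated matrix elements. Where the weight \<open>c i\<close> is zero, the target
  \<open>s i\<close> may leave \<open>I\<close>.\<close>

lemma orthonormal_basis_adj_shift:
  assumes onb: "orthonormal_basis I b"
    and A: "\<And>i. i \<in> I \<Longrightarrow> A *v b i = c i *s b (s i)"
    and s: "\<And>i. i \<in> I \<Longrightarrow> c i \<noteq> 0 \<Longrightarrow> s i \<in> I"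
    and j: "j \<in> I"
  shows "adj A *v b j = (\<Sum>i\<in>I. (if c i \<noteq> 0 \<and> s i = j then cnj (c i) else 0) *s b i)"
proof -
  have "cinner (b i) (adj A *v b j) = (if c i \<noteq> 0 \<and> s i = j then cnj (c i) else 0)" if "i \<in> I" for i
  proof -
    have "cinner (b i) (adj A *v b j) = cnj (c i) * cinner (b (s i)) (b j)"
      using A[OF that] by (simp add: cinner_adj adj_adj cinner_scale_left)
    then show ?thesis using s[OF that] onb j
      by (cases "c i = 0") (auto simp: orthonormal_basis_def)
  qed
  then show ?thesis
    by (subst orthonormal_basis_expansion[OF onb]) (simp cong: sum.cong)
qed


section \<open>Gelfand-Tsetlin labels and weights\<close>

text \<open>The integers \<open>rm\<close>, \<open>rp\<close>, \<open>n\<close> are coordinates on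
  Gelfand-Tsetlin patterns in which the lowering operators move by unit steps.\<close>

definition gt_wt :: "nat \<times> nat \<Rightarrow> int \<Rightarrow> int \<Rightarrow> int \<Rightarrow> weight" where
  "gt_wt a rm rp n = (int (fst a) + 2 * int (snd a) - (rp + rm), rp + rm - n, n)"

definition gt_range :: "nat \<times> nat \<Rightarrow> int \<Rightarrow> int \<Rightarrow> int \<Rightarrow> bool" where
  "gt_range a rm rp n \<longleftrightarrow> 0 \<le> rm \<and> rm \<le> int (snd a) \<and> int (snd a) \<le> rp \<and>
     rp \<le> int (fst a) + int (snd a) \<and> rm \<le> n \<and> n \<le> rp"

lemma gt_labels_eq:
  "gt_labels a = {(gt_wt a rm rp n, of_int (rp - rm) / 2) | rm rp n. gt_range a rm rp n}"
  by (simp add: gt_labels_def gt_wt_def gt_range_def)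

lemma gt_labelsI: "gt_range a rm rp n \<Longrightarrow> (gt_wt a rm rp n, of_int (rp - rm) / 2) \<in> gt_labels a"
  unfolding gt_labels_eq by blast

lemma gt_labelsE:
  assumes "(\<nu>, J) \<in> gt_labels a"
  obtains rm rp n where "gt_range a rm rp n" "\<nu> = gt_wt a rm rp n" "J = of_int (rp - rm) / 2"
  using assms unfolding gt_labels_eq by blast

lemma finite_gt_labels: "finite (gt_labels a)"
proof -
  let ?R = "{0..int (fst a) + int (snd a)}"
  have "gt_labels a \<subseteq> (\<lambda>(rm, rp, n). (gt_wt a rm rp n, of_int (rp - rm) / 2)) ` (?R \<times> ?R \<times> ?R)"
  proof
    fix x assume "x \<in> gt_labels a"
    then obtain rm rp n where "gt_range a rm rp n" "x = (gt_wt a rm rp n, of_int (rp - rm) / 2)"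
      by (cases x) (auto elim: gt_labelsE)
    then show "x \<in> (\<lambda>(rm, rp, n). (gt_wt a rm rp n, of_int (rp - rm) / 2)) ` (?R \<times> ?R \<times> ?R)"
      by (intro image_eqI[of _ _ "(rm, rp, n)"]) (auto simp: gt_range_def)
  qed
  then show ?thesis by (rule finite_subset) simp
qed

text \<open>With s the size of \<open>a\<close>, the check reflects the pattern: every coordinate is
  subtracted from s, so the bounds \<open>rm\<close> and \<open>rp\<close> trade places and
  \<open>J\<close> is kept.\<close>

lemma check_weight_gt_labels:
  assumes "(\<nu>, J) \<in> gt_labels a"
  shows "(check_weight (size_of a) \<nu>, J) \<in> gt_labels (prod.swap a)"
proof -
  obtain rm rp n where *: "gt_range a rm rp n" "\<nu> = gt_wt a rm rp n" "J = of_int (rp - rm) / 2"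
    using assms by (rule gt_labelsE)
  let ?s = "int (fst a) + int (snd a)"
  have "gt_range (prod.swap a) (?s - rp) (?s - rm) (?s - n)"
    using *(1) by (auto simp: gt_range_def)
  moreover have "gt_wt (prod.swap a) (?s - rp) (?s - rm) (?s - n) = check_weight (size_of a) \<nu>"
    by (simp add: *(2) gt_wt_def check_weight_def size_of_def)
  moreover have "of_int ((?s - rm) - (?s - rp)) / 2 = J" by (simp add: *(3))
  ultimately show ?thesis using gt_labelsI by metis
qed

lemma check_weight_involutive: "check_weight s (check_weight s \<nu>) = \<nu>"
  by (cases \<nu>) (simp add: check_weight_def)

lemma bij_check_weight:
  "bij_betw (\<lambda>(\<nu>, J). (check_weight (size_of a) \<nu>, J)) (gt_labels (prod.swap a)) (gt_labels a)"
proof (rule bij_betw_byWitness[where f' = "\<lambda>(\<nu>, J). (check_weight (size_of a) \<nu>, J)"])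
  have "size_of (prod.swap a) = size_of a" by (simp add: size_of_def)
  then show "(\<lambda>(\<nu>, J). (check_weight (size_of a) \<nu>, J)) ` gt_labels (prod.swap a) \<subseteq> gt_labels a"
    using check_weight_gt_labels[of _ _ "prod.swap a"] by auto
qed (auto simp: check_weight_involutive check_weight_gt_labels)

text \<open>For fixed \<open>rm\<close> and \<open>rp\<close> the labels form one string of U-spin
  \<open>J\<close>, with \<open>n\<close> running from \<open>rm\<close> to \<open>rp\<close>. Here
  m = n - rm and l = rp - n are the distances to its top and bottom.\<close>

lemma gt_string:
  assumes "((n1, n2, n3), J) \<in> gt_labels a"
  obtains m l :: nat where
    "J - u_of (n1, n2, n3) = m" "J + u_of (n1, n2, n3) = l"
    "\<And>i. i \<le> m + l \<Longrightarrow> ((n1, n2 + int m - int i, n3 - int m + int i), J) \<in> gt_labels a"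
proof -
  obtain rm rp n where *: "gt_range a rm rp n" "(n1, n2, n3) = gt_wt a rm rp n" "J = of_int (rp - rm) / 2"
    using assms by (rule gt_labelsE)
  show thesis
  proof (rule that[of "nat (n - rm)" "nat (rp - n)"])
    fix i assume "i \<le> nat (n - rm) + nat (rp - n)"
    then have "gt_range a rm rp (rm + int i)"
      using *(1) by (auto simp: gt_range_def)
    moreover have "gt_wt a rm rp (rm + int i) = (n1, n2 + int (nat (n - rm)) - int i, n3 - int (nat (n - rm)) + int i)"
      using *(1,2) by (auto simp: gt_wt_def gt_range_def)
    ultimately show "((n1, n2 + int (nat (n - rm)) - int i, n3 - int (nat (n - rm)) + int i), J) \<in> gt_labels a"
      using *(3) gt_labelsI by metis
  qed (use * in \<open>auto simp: gt_wt_def gt_range_def u_of_def field_simps\<close>)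
qed

section \<open>The lowering operators and weights in pattern coordinates\<close>

lemma gt_basis_U_minus:
  assumes "gt_basis R V a e" "((n1, n2, n3), J) \<in> gt_labels a"
  shows "U_minus R *v e (n1, n2, n3) J =
    complex_of_real (sqrt ((J + u_of (n1, n2, n3)) * (J - u_of (n1, n2, n3) + 1))) *s e (n1, n2 - 1, n3 + 1) J"
  using assms unfolding gt_basis_def Let_def by blast

text \<open>The two terms of the lowering formula raise \<open>rm\<close> and \<open>rp\<close>
  respectively. In these coordinates the radicands are quotients of products of integers, which
  shows where they vanish.\<close>

lemma gt_basis_T_minus:
  assumes gt: "gt_basis R V a e" and rng: "gt_range a rm rp n"
  shows "T_minus R *v e (gt_wt a rm rp n) (of_int (rp - rm) / 2) =
    complex_of_real (sqrt (of_int ((n - rm) * (int (fst a) + int (snd a) - rm + 1) * (int (snd a) - rm) * (rm + 1))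
       / of_int ((rp - rm) * (rp - rm + 1))))
      *s e (gt_wt a (rm + 1) rp n) (of_int (rp - (rm + 1)) / 2) +
    complex_of_real (sqrt (of_int ((rp - n + 1) * (int (fst a) + int (snd a) - rp) * (rp + 1 - int (snd a)) * (rp + 2))
       / of_int ((rp - rm + 2) * (rp - rm + 1))))
      *s e (gt_wt a rm (rp + 1) n) (of_int (rp + 1 - rm) / 2)"
proof -
  define n1 n2 J where "n1 = int (fst a) + 2 * int (snd a) - (rp + rm)" and "n2 = rp + rm - n"
    and "J = (of_int (rp - rm) / 2 :: real)"
  define u P Q N where "u = u_of (n1, n2, n)" and "P = real_of_int (int (fst a))"
    and "Q = real_of_int (int (snd a))" and "N = real_of_int n"
  have lab: "((n1, n2, n), J) \<in> gt_labels a"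
    using gt_labelsI[OF rng] by (simp add: gt_wt_def n1_def n2_def J_def)
  have "T_minus R *v e (n1, n2, n) J =
      complex_of_real (sqrt ((J - u) * (P + Q + J - u - N + 1) * (Q + J - u - N) * (u - J + N + 1)
                 / (2 * J * (2 * J + 1)))) *s e (n1 - 1, n2 + 1, n) (J - 1/2) +
             complex_of_real (sqrt ((J + u + 1) * (P + Q - J - u - N) * (J + u + 1 + N - Q) * (J + u + 2 + N)
                 / (2 * (J + 1) * (2 * J + 1)))) *s e (n1 - 1, n2 + 1, n) (J + 1/2)"
    using gt lab unfolding gt_basis_def Let_def u_def P_def Q_def N_def by blast
  moreover have a: "J - u = of_int (n - rm)" "J + u = of_int (rp - n)" "2 * J = of_int (rp - rm)"
    by (simp_all add: J_def u_def u_of_def n2_def field_simps)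
  have "P + Q + J - u - N + 1 = of_int (int (fst a) + int (snd a) - rm + 1)"
    "Q + J - u - N = of_int (int (snd a) - rm)" "u - J + N + 1 = of_int (rm + 1)"
    "J + u + 1 = of_int (rp - n + 1)" "P + Q - J - u - N = of_int (int (fst a) + int (snd a) - rp)"
    "J + u + 1 + N - Q = of_int (rp + 1 - int (snd a))" "J + u + 2 + N = of_int (rp + 2)"
    "2 * J + 1 = of_int (rp - rm + 1)" "2 * (J + 1) = of_int (rp - rm + 2)"
    using a by (simp_all add: P_def Q_def N_def)
  then have "(J - u) * (P + Q + J - u - N + 1) * (Q + J - u - N) * (u - J + N + 1)
        = of_int ((n - rm) * (int (fst a) + int (snd a) - rm + 1) * (int (snd a) - rm) * (rm + 1))"
      "(J + u + 1) * (P + Q - J - u - N) * (J + u + 1 + N - Q) * (J + u + 2 + N)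
        = of_int ((rp - n + 1) * (int (fst a) + int (snd a) - rp) * (rp + 1 - int (snd a)) * (rp + 2))"
      "2 * J * (2 * J + 1) = of_int ((rp - rm) * (rp - rm + 1))"
      "2 * (J + 1) * (2 * J + 1) = of_int ((rp - rm + 2) * (rp - rm + 1))"
    using a by (simp_all only: of_int_mult)
  moreover have "J - 1/2 = of_int (rp - (rm + 1)) / 2" "J + 1/2 = of_int (rp + 1 - rm) / 2"
    by (simp_all add: J_def field_simps)
  moreover have "(n1 - 1, n2 + 1, n) = gt_wt a (rm + 1) rp n" "(n1 - 1, n2 + 1, n) = gt_wt a rm (rp + 1) n"
    "(n1, n2, n) = gt_wt a rm rp n"
    by (simp_all add: gt_wt_def n1_def n2_def)
  ultimately show ?thesis unfolding J_def[symmetric] by metis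
qed

text \<open>Eigenspaces are subspaces, so \<open>y\<close> can be solved for. This isolates one of
  the two terms produced by \<open>T_minus\<close>.\<close>

lemma eigenvector_combination:
  fixes H :: "complex^'m^'m"
  assumes "H *v x = l *s x" "H *v z = l *s z" "x = c *s y + d *s z" "c \<noteq> 0"
  shows "H *v y = l *s y"
proof -
  have "c *s (H *v y) + d *s (l *s z) = l *s (c *s y + d *s z)"
    using assms(1,2) unfolding assms(3) by (simp add: vector_scalar_commute matrix_vector_right_distrib)
  then have "c * (H *v y) $ i = c * (l * y $ i)" for i
    by (auto simp: vec_eq_iff algebra_simps)
  then show ?thesis using assms(4) by (simp add: vec_eq_iff)
qed

lemma eigenvector_scale:
  fixes H :: "complex^'m^'m"
  assumes "H *v x = l *s x" "x = c *s y" "c \<noteq> 0"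
  shows "H *v y = l *s y"
  using assms eigenvector_combination[of H x l 0 c y 0] by simp

lemma eigenvector_shift:
  fixes H :: "complex^'m^'m"
  assumes "H *v (M *v v) = M *v (H *v v) + d *s (M *v v)" "H *v v = l *s v"
  shows "H *v (M *v v) = (l + d) *s (M *v v)"
  using assms by (simp add: vector_scalar_commute vector_sadd_rdistrib)

text \<open>Every pattern is reached from the highest weight pattern (0, q, 0). A step of
  \<open>U_minus\<close> raises \<open>n\<close> and shifts the eigenvalue by
  \<open>\<alpha>\<close>; a step of \<open>T_minus\<close> raises \<open>rm + rp\<close> and shifts
  it by \<open>\<beta>\<close>.\<close>

lemma gt_basis_eigenvector:
  assumes gt: "gt_basis R V a e"
    and HU: "\<And>v. H *v (U_minus R *v v) = U_minus R *v (H *v v) + \<alpha> *s (U_minus R *v v)"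
    and HT: "\<And>v. H *v (T_minus R *v v) = T_minus R *v (H *v v) + \<beta> *s (T_minus R *v v)"
    and hw: "H *v e (gt_wt a 0 (int (snd a)) 0) (of_nat (snd a) / 2)
       = l0 *s e (gt_wt a 0 (int (snd a)) 0) (of_nat (snd a) / 2)"
    and "gt_range a rm rp n"
  shows "H *v e (gt_wt a rm rp n) (of_int (rp - rm) / 2) =
     (l0 + \<alpha> * of_int n + \<beta> * of_int (rm + rp - int (snd a))) *s e (gt_wt a rm rp n) (of_int (rp - rm) / 2)"
proof -
  define g where "g = (\<lambda>rm rp n. e (gt_wt a rm rp n) (of_int (rp - rm) / 2))"
  define l where "l = (\<lambda>rm rp n. l0 + \<alpha> * of_int n + \<beta> * of_int (rm + rp - int (snd a)))"
  define good where "good = (\<lambda>rm rp n. H *v g rm rp n = l rm rp n *s g rm rp n)"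
  let ?p = "int (fst a)" and ?q = "int (snd a)"
  have lowerU: "good rm rp (n + 1)" if "good rm rp n" "gt_range a rm rp n" "n < rp" for rm rp n
  proof -
    \<comment> \<open>Here J + u = rp - n and J - u = n - rm; the radicand is positive as long as n
      < rp.\<close>
    define c where "c = complex_of_real (sqrt (of_int ((rp - n) * (n - rm + 1))))"
    have "U_minus R *v g rm rp n = c *s g rm rp (n + 1)"
    proof -
      have "(of_int (rp - rm) / 2 + u_of (gt_wt a rm rp n)) * (of_int (rp - rm) / 2 - u_of (gt_wt a rm rp n) + 1)
          = real_of_int ((rp - n) * (n - rm + 1))"
        by (simp add: gt_wt_def u_of_def field_simps)
      then show ?thesis
        using gt_basis_U_minus[OF gt gt_labelsI[OF that(2), unfolded gt_wt_def]]
        by (simp add: g_def c_def gt_wt_def algebra_simps)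
    qed
    moreover have "c \<noteq> 0" using that by (auto simp: c_def gt_range_def)
    moreover have "H *v (U_minus R *v g rm rp n) = l rm rp (n + 1) *s (U_minus R *v g rm rp n)"
      using eigenvector_shift[OF HU that(1)[unfolded good_def]] by (simp add: l_def algebra_simps)
    ultimately show ?thesis unfolding good_def
      by (metis eigenvector_scale)
  qed
  have string: "good rm rp n" if "good rm rp rm" "gt_range a rm rp n" for rm rp n
  proof -
    have "rm \<le> n" using that(2) by (simp add: gt_range_def)
    then have "n \<le> rp \<longrightarrow> good rm rp n"
    proof (induction n rule: int_ge_induct)
      case (step i)
      then show ?case using lowerU[of rm rp i] that(2) by (auto simp: gt_range_def)
    qed (use that in simp)
    then show ?thesis using that(2) by (simp add: gt_range_def)
  qed
  have lowerT: "H *v (T_minus R *v g rm rp n) = l rm (rp + 1) n *s (T_minus R *v g rm rp n)"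
    if "good rm rp n" for rm rp n
    using eigenvector_shift[OF HT that[unfolded good_def]] by (simp add: l_def algebra_simps)
  \<comment> \<open>Raising \<open>rp\<close> starts from \<open>n = rm\<close>, where the other term of \<open>T\<^sub>-\<close> vanishes. Raising \<open>rm\<close> needs
    \<open>n = rm + 1\<close> and uses the induction hypothesis for the term with \<open>rp + 1\<close>.\<close>
  have top: "\<forall>rp. ?q \<le> rp \<and> rp \<le> ?p + ?q \<longrightarrow> good rm rp rm" if "0 \<le> rm" "rm \<le> ?q" for rm
    using that
  proof (induction rm rule: int_ge_induct)
    case base
    show ?case
    proof (intro allI impI)
      fix rp assume "?q \<le> rp \<and> rp \<le> ?p + ?q"
      then have "?q \<le> rp" "rp \<le> ?p + ?q" by auto
      then show "good 0 rp 0"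
      proof (induction rp rule: int_ge_induct)
        case base
        then show ?case using hw by (simp add: good_def g_def l_def)
      next
        case (step rp)
        then have g: "good 0 rp 0" and rng: "gt_range a 0 rp 0" by (auto simp: gt_range_def)
        define c where "c = complex_of_real (sqrt (of_int ((rp + 1) * (?p + ?q - rp) * (rp + 1 - ?q) * (rp + 2))
          / of_int ((rp + 2) * (rp + 1))))"
        have "T_minus R *v g 0 rp 0 = c *s g 0 (rp + 1) 0"
          using gt_basis_T_minus[OF gt rng] by (simp add: g_def c_def)
        moreover have "c \<noteq> 0" using step by (auto simp: c_def)
        ultimately show ?case using lowerT[OF g] unfolding good_def
          by (metis eigenvector_scale)
      qed
    qed
  next
    case (step rm)
    have IH: "good rm rp n" if "gt_range a rm rp n" for rp n
      by (rule string) (use step that in \<open>auto simp: gt_range_def\<close>)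
    show ?case
    proof (intro allI impI)
      fix rp assume rp: "?q \<le> rp \<and> rp \<le> ?p + ?q"
      let ?n = "rm + 1"
      have rng: "gt_range a rm rp ?n" using rp step by (auto simp: gt_range_def)
      define c where "c = complex_of_real (sqrt (of_int ((?n - rm) * (?p + ?q - rm + 1) * (?q - rm) * (rm + 1))
       / of_int ((rp - rm) * (rp - rm + 1))))"
      define d where "d = complex_of_real (sqrt (of_int ((rp - ?n + 1) * (?p + ?q - rp) * (rp + 1 - ?q) * (rp + 2))
       / of_int ((rp - rm + 2) * (rp - rm + 1))))"
      \<comment> \<open>For rp = p + q the pattern with \<open>rp + 1\<close> does not exist. Its
        coefficient \<open>d\<close> vanishes, so the zero vector can stand in and satisfies the
        eigenvalue equation.\<close>
      define z where "z = (if rp < ?p + ?q then g rm (rp + 1) ?n else 0)"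
      have "d = 0" if "\<not> rp < ?p + ?q" using that rp by (simp add: d_def)
      then have T: "T_minus R *v g rm rp ?n = c *s g (rm + 1) rp ?n + d *s z"
        using gt_basis_T_minus[OF gt rng] by (auto simp: g_def c_def d_def z_def)
      \<comment> \<open>Since rm < q \<le> rp, both the factor q - rm and the denominator are
        positive.\<close>
      have "c \<noteq> 0" using step rp by (auto simp: c_def)
      have z: "H *v z = l (rm + 1) rp ?n *s z"
      proof (cases "rp < ?p + ?q")
        case True
        then have "gt_range a rm (rp + 1) ?n" using rp step by (auto simp: gt_range_def)
        from IH[OF this] True show ?thesis
          by (simp add: good_def z_def l_def algebra_simps)
      qed (simp add: z_def)
      have "H *v (T_minus R *v g rm rp ?n) = l (rm + 1) rp ?n *s (T_minus R *v g rm rp ?n)"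
        using lowerT[OF IH[OF rng]] by (simp add: l_def algebra_simps)
      from eigenvector_combination[OF this z T \<open>c \<noteq> 0\<close>]
      show "good (rm + 1) rp ?n" by (simp add: good_def)
    qed
  qed
  have "good rm rp n"
    by (rule string) (use assms(5) top in \<open>auto simp: gt_range_def\<close>)
  then show ?thesis by (simp add: good_def g_def l_def)
qed


section \<open>Coupled bases\<close>

text \<open>By the Jacobi identity the commutator action is itself a representation of sl(3), so the
  bracket relation carries over to operators.\<close>

lemma tensor_dual_alg_commute:
  assumes rep: "su3_unitary_rep \<pi> \<rho>" and "X \<in> sl3" "Y \<in> sl3" and XY: "commutator X Y = cscale c Y"
  shows "tensor_dual_alg \<rho> X *v (tensor_dual_alg \<rho> Y *v v)
     = tensor_dual_alg \<rho> Y *v (tensor_dual_alg \<rho> X *v v) + c *s (tensor_dual_alg \<rho> Y *v v)"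
proof -
  have "commutator (\<rho> X) (\<rho> Y) = \<rho> (commutator X Y)" "\<rho> (cscale c Y) = cscale c (\<rho> Y)"
    using assms(1-3) by (simp_all add: su3_unitary_rep_def)
  then have "commutator (\<rho> X) (\<rho> Y) = cscale c (\<rho> Y)"
    by (simp only: XY)
  then show ?thesis
    using commutator_Jacobi[of "\<rho> X" "\<rho> Y" "to_op v"]
    by (simp add: to_op_inject[symmetric] to_op_add to_op_scale to_op_tensor_dual_alg
        commutator_cscale_left algebra_simps)
qed

text \<open>The shifts are minus one half of the entries of the Cartan matrix of sl(3).\<close>

lemma sl3_brackets:
  fixes T U :: "complex^3^3"
  defines "T \<equiv> cscale (1/2) (E_unit 1 1 - E_unit 2 2)" and "U \<equiv> cscale (1/2) (E_unit 2 2 - E_unit 3 3)"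
  shows "T \<in> sl3" "U \<in> sl3"
    "commutator T (E_unit 2 1) = cscale (-1) (E_unit 2 1)"
    "commutator T (E_unit 3 2) = cscale (1/2) (E_unit 3 2)"
    "commutator U (E_unit 2 1) = cscale (1/2) (E_unit 2 1)"
    "commutator U (E_unit 3 2) = cscale (-1) (E_unit 3 2)"
  by (simp_all add: T_def U_def sl3_def trace_def E_unit_def cscale_def commutator_def
      matrix_matrix_mult_def vec_eq_iff forall_3 sum_3)

text \<open>A Gelfand-Tsetlin basis prescribes these eigenvalues on the highest weight vector only;
  the lowering operators carry them to all labels, with shifts given by the brackets.\<close>

lemma gt_basis_weight:
  assumes rep: "su3_unitary_rep \<pi> \<rho>" and gt: "gt_basis (tensor_dual_alg \<rho>) V a e"
    and "(\<nu>, J) \<in> gt_labels a"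
  shows "T_three (tensor_dual_alg \<rho>) *v e \<nu> J = complex_of_real (t_of \<nu>) *s e \<nu> J"
    and "U_three (tensor_dual_alg \<rho>) *v e \<nu> J = complex_of_real (u_of \<nu>) *s e \<nu> J"
proof -
  obtain rm rp n where *: "gt_range a rm rp n" "\<nu> = gt_wt a rm rp n" "J = of_int (rp - rm) / 2"
    using assms(3) by (rule gt_labelsE)
  have "(2::3) \<noteq> 1" "(3::3) \<noteq> 2" by simp_all
  note sl3 = sl3_off_diagonal[OF this(1)] sl3_off_diagonal[OF this(2)]
  note comm = tensor_dual_alg_commute[OF rep]
  have hw: "highest_weight_vector (tensor_dual_alg \<rho>) a (e (gt_wt a 0 (int (snd a)) 0) (of_nat (snd a) / 2))"
  proof -
    have "highest_weight_vector (tensor_dual_alg \<rho>) a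
        (e (int (fst a) + int (snd a), int (snd a), 0) (of_int (int (snd a)) / 2))"
      using gt unfolding gt_basis_def Let_def by blast
    moreover have "gt_wt a 0 (int (snd a)) 0 = (int (fst a) + int (snd a), int (snd a), 0)"
      by (simp add: gt_wt_def)
    ultimately show ?thesis by (simp only: of_int_of_nat_eq)
  qed
  have "T_three (tensor_dual_alg \<rho>) *v e \<nu> J = (of_nat (fst a) / 2 + 1/2 * of_int n
      + (-1) * of_int (rm + rp - int (snd a))) *s e \<nu> J"
    unfolding *(2,3)
    by (rule gt_basis_eigenvector[OF gt _ _ _ *(1)])
       (use hw comm[OF sl3_brackets(1) sl3(2) sl3_brackets(4)] comm[OF sl3_brackets(1) sl3(1) sl3_brackets(3)]
         in \<open>simp_all add: T_three_def T_minus_def U_minus_def highest_weight_vector_def\<close>)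
  moreover have "(of_nat (fst a) / 2 + 1/2 * of_int n + (-1) * of_int (rm + rp - int (snd a))) = complex_of_real (t_of \<nu>)"
    by (simp add: *(2) t_of_def gt_wt_def field_simps)
  ultimately show "T_three (tensor_dual_alg \<rho>) *v e \<nu> J = complex_of_real (t_of \<nu>) *s e \<nu> J"
    by (simp only:)
  have "U_three (tensor_dual_alg \<rho>) *v e \<nu> J = (of_nat (snd a) / 2 + (-1) * of_int n
      + 1/2 * of_int (rm + rp - int (snd a))) *s e \<nu> J"
    unfolding *(2,3)
    by (rule gt_basis_eigenvector[OF gt _ _ _ *(1)])
       (use hw comm[OF sl3_brackets(2) sl3(2) sl3_brackets(6)] comm[OF sl3_brackets(2) sl3(1) sl3_brackets(5)]
         in \<open>simp_all add: U_three_def T_minus_def U_minus_def highest_weight_vector_def\<close>)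
  moreover have "(of_nat (snd a) / 2 + (-1) * of_int n + 1/2 * of_int (rm + rp - int (snd a))) = complex_of_real (u_of \<nu>)"
    by (simp add: *(2) u_of_def gt_wt_def field_simps)
  ultimately show "U_three (tensor_dual_alg \<rho>) *v e \<nu> J = complex_of_real (u_of \<nu>) *s e \<nu> J"
    by (simp only:)
qed

lemma matrix_vector_mult_sum: "A *v sum f I = (\<Sum>i\<in>I. A *v f i)"
  by (induction I rule: infinite_finite_induct) (simp_all add: matrix_vector_right_distrib)

text \<open>Compare the coefficient of \<open>b i\<close> in \<open>H *v z\<close>, computed once
  from the expansion of \<open>z\<close> and once from the eigenvalue equation.\<close>

lemma orthonormal_basis_eigenvalue:
  assumes onb: "orthonormal_basis I b" and H: "\<And>i. i \<in> I \<Longrightarrow> H *v b i = l i *s b i"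
    and z: "H *v z = c *s z" and i: "i \<in> I" and "cinner (b i) z \<noteq> 0"
  shows "l i = c"
proof -
  have "H *v z = (\<Sum>j\<in>I. (l j * cinner (b j) z) *s b j)"
    using arg_cong[OF orthonormal_basis_expansion[OF onb, of z], of "(*v) H"]
    by (simp add: matrix_vector_mult_sum vector_scalar_commute H mult.commute)
  then have "cinner (b i) (H *v z) = (\<Sum>j\<in>I. l j * cinner (b j) z * cinner (b i) (b j))"
    by (simp add: cinner_sum_right cinner_scale_right)
  also have "\<dots> = (\<Sum>j\<in>I. if i = j then l j * cinner (b j) z else 0)"
    using onb i by (intro sum.cong) (auto simp: orthonormal_basis_def)
  also have "\<dots> = l i * cinner (b i) z"
    using onb i by (simp add: orthonormal_basis_def)
  finally show ?thesis using assms(5) by (simp add: z cinner_scale_right)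
qed

lemma gt_basis_cinner:
  assumes "gt_basis R V a e" "(\<nu>, J) \<in> gt_labels a" "(\<nu>', J') \<in> gt_labels a"
  shows "cinner (e \<nu> J) (e \<nu>' J') = (if (\<nu>, J) = (\<nu>', J') then 1 else 0)"
  using assms unfolding gt_basis_def by blast

lemma gt_basis_span:
  assumes "gt_basis R V a e"
  shows "vec.span {e \<nu> J | \<nu> J. (\<nu>, J) \<in> gt_labels a} = V"
  using assms unfolding gt_basis_def by blast

lemma gt_basis_orthonormal:
  assumes "gt_basis R UNIV p e"
  shows "orthonormal_basis (gt_labels p) (\<lambda>(\<nu>, J). e \<nu> J)"
proof -
  have "(\<lambda>(\<nu>, J). e \<nu> J) ` gt_labels p = {e \<nu> J | \<nu> J. (\<nu>, J) \<in> gt_labels p}"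
    by (force simp: image_iff)
  then show ?thesis
    unfolding orthonormal_basis_def
    using gt_basis_cinner[OF assms] gt_basis_span[OF assms]
    by (simp add: finite_gt_labels split_paired_all Ball_def)
qed

definition coupled_labels :: "(nat \<times> nat \<Rightarrow> nat) \<Rightarrow> (irrep_index \<times> weight \<times> real) set" where
  "coupled_labels m = Sigma (cg_series m) (\<lambda>k. gt_labels (fst k))"

lemma coupled_basis_orthonormal:
  assumes dec: "orthogonal_irrep_decomposition P R m W"
    and gt: "\<And>k. k \<in> cg_series m \<Longrightarrow> gt_basis R (W k) (fst k) (E k)"
  shows "orthonormal_basis (coupled_labels m) (\<lambda>(k, \<nu>, J). E k \<nu> J)"
  unfolding orthonormal_basis_def
proof (intro conjI ballI)
  let ?b = "\<lambda>(k, \<nu>, J). E k \<nu> J"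
  show "finite (coupled_labels m)"
    using dec by (simp add: coupled_labels_def orthogonal_irrep_decomposition_def finite_gt_labels)
  have W: "W k = vec.span {E k \<nu> J | \<nu> J. (\<nu>, J) \<in> gt_labels (fst k)}" if "k \<in> cg_series m" for k
    using gt_basis_span[OF gt[OF that]] by simp
  show "cinner (?b i) (?b j) = (if i = j then 1 else 0)"
    if "i \<in> coupled_labels m" "j \<in> coupled_labels m" for i j
  proof -
    obtain k \<nu> J k' \<nu>' J' where ij: "i = (k, \<nu>, J)" "j = (k', \<nu>', J')" by (metis prod_cases3)
    have k: "k \<in> cg_series m" "k' \<in> cg_series m" "(\<nu>, J) \<in> gt_labels (fst k)" "(\<nu>', J') \<in> gt_labels (fst k')"
      using that by (auto simp: ij coupled_labels_def)
    show ?thesis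
    proof (cases "k = k'")
      case True
      then show ?thesis using gt_basis_cinner[OF gt[OF k(1)]] k(3,4) by (simp add: ij)
    next
      case False
      have "E k \<nu> J \<in> W k" "E k' \<nu>' J' \<in> W k'"
        unfolding W[OF k(1)] W[OF k(2)] by (intro vec.span_base; use k in blast)+
      then show ?thesis using dec k(1,2) False by (auto simp: ij orthogonal_irrep_decomposition_def)
    qed
  qed
  have "W k \<subseteq> vec.span (?b ` coupled_labels m)" if "k \<in> cg_series m" for k
    unfolding W[OF that] using that
    by (intro vec.span_mono) (force simp: coupled_labels_def)
  then have "(\<Union>k\<in>cg_series m. W k) \<subseteq> vec.span (?b ` coupled_labels m)" by blast
  then have "vec.span (\<Union>k\<in>cg_series m. W k) \<subseteq> vec.span (?b ` coupled_labels m)"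
    by (intro vec.span_minimal) simp_all
  then show "vec.span (?b ` coupled_labels m) = UNIV"
    using dec by (auto simp: orthogonal_irrep_decomposition_def)
qed

section \<open>Raising operators and ladders in the coupled basis\<close>

lemma adj_U_minus_tensor:
  assumes "su3_unitary_rep \<pi> \<rho>"
  shows "adj (U_minus (tensor_dual_alg \<rho>)) = U_plus (tensor_dual_alg \<rho>)"
proof -
  have "cnj (\<rho> (E_unit 3 2) $ j $ i) = \<rho> (E_unit 2 3) $ i $ j" for i j
    using arg_cong[OF adj_U_minus[OF assms], of "\<lambda>M. M $ i $ j"]
    by (simp add: U_minus_def U_plus_def adj_def)
  then show ?thesis
    by (auto simp: U_minus_def U_plus_def adj_def tensor_dual_alg_def tensor_mat_def mat_def
        transpose_def vec_eq_iff)
qed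

text \<open>The raising formula is recovered from the lowering formula: \<open>U_minus\<close> is a
  weighted shift of the whole coupled basis, and its adjoint shifts back with the same real
  weights.\<close>

lemma coupled_basis_U_plus:
  assumes onb: "orthonormal_basis (coupled_labels m) (\<lambda>(k, \<nu>, J). E k \<nu> J)"
    and gt: "\<And>k. k \<in> cg_series m \<Longrightarrow> gt_basis R (W k) (fst k) (E k)"
    and k: "k \<in> cg_series m" and lab: "((n1, n2, n3), J) \<in> gt_labels (fst k)"
  shows "adj (U_minus R) *v E k (n1, n2, n3) J =
    complex_of_real (sqrt ((J - u_of (n1, n2, n3)) * (J + u_of (n1, n2, n3) + 1))) *s E k (n1, n2 + 1, n3 - 1) J"
proof -
  define s :: "irrep_index \<times> weight \<times> real \<Rightarrow> irrep_index \<times> weight \<times> real"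
    where "s = (\<lambda>(k, (n1, n2, n3), J). (k, (n1, n2 - 1, n3 + 1), J))"
  define c :: "irrep_index \<times> weight \<times> real \<Rightarrow> complex"
    where "c = (\<lambda>(k, \<nu>, J). complex_of_real (sqrt ((J + u_of \<nu>) * (J - u_of \<nu> + 1))))"
  let ?b = "\<lambda>(k, \<nu>, J). E k \<nu> J" and ?I = "coupled_labels m"
  let ?j = "(k, (n1, n2, n3), J)" and ?i = "(k, (n1, n2 + 1, n3 - 1), J)"
  have "adj (U_minus R) *v ?b ?j = (\<Sum>i\<in>?I. (if c i \<noteq> 0 \<and> s i = ?j then cnj (c i) else 0) *s ?b i)"
  proof (rule orthonormal_basis_adj_shift[OF onb])
    fix i assume "i \<in> ?I"
    then obtain k' n1' n2' n3' J' where i: "i = (k', (n1', n2', n3'), J')" "k' \<in> cg_series m"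
      "((n1', n2', n3'), J') \<in> gt_labels (fst k')"
      by (auto simp: coupled_labels_def)
    show "U_minus R *v ?b i = c i *s ?b (s i)"
      using gt_basis_U_minus[OF gt[OF i(2)] i(3)] by (simp add: i(1) c_def s_def)
    obtain m' l :: nat where ml: "J' - u_of (n1', n2', n3') = m'" "J' + u_of (n1', n2', n3') = l"
      "\<And>i. i \<le> m' + l \<Longrightarrow> ((n1', n2' + int m' - int i, n3' - int m' + int i), J') \<in> gt_labels (fst k')"
      using gt_string[OF i(3)] by metis
    \<comment> \<open>A nonzero coefficient means that the label is not at the bottom of its string,
      so the next one is a label too.\<close>
    assume "c i \<noteq> 0"
    then have "l \<noteq> 0" by (auto simp: c_def i(1) ml)
    then show "s i \<in> ?I" using ml(3)[of "m' + 1"] i(2) by (simp add: i(1) s_def coupled_labels_def)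
  qed (use k lab in \<open>simp add: coupled_labels_def\<close>)
  also have "\<dots> = (\<Sum>i\<in>?I. if i = ?i then cnj (c ?i) *s ?b ?i else 0)"
    by (intro sum.cong refl) (auto simp: s_def)
  also have "\<dots> = c ?i *s ?b ?i"
  proof (cases "?i \<in> ?I")
    case True
    then show ?thesis using onb by (simp add: orthonormal_basis_def c_def)
  next
    case False
    \<comment> \<open>If there is no label above, the given one is at the top of its string, where J
      = u and the coefficient vanishes.\<close>
    obtain m' l :: nat where ml: "J - u_of (n1, n2, n3) = m'"
      "\<And>i. i \<le> m' + l \<Longrightarrow> ((n1, n2 + int m' - int i, n3 - int m' + int i), J) \<in> gt_labels (fst k)"
      using gt_string[OF lab] by metis
    have "m' = 0"
    proof (rule ccontr)
      assume "m' \<noteq> 0"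
      then have "((n1, n2 + 1, n3 - 1), J) \<in> gt_labels (fst k)"
        using ml(2)[of "m' - 1"] by (simp add: of_nat_diff)
      then show False using False k by (simp add: coupled_labels_def)
    qed
    moreover have "u_of (n1, n2 + 1, n3 - 1) = u_of (n1, n2, n3) + 1"
      by (simp add: u_of_def field_simps)
    ultimately have "c ?i = 0" using ml(1) by (simp add: c_def)
    then show ?thesis using False by (intro sum.neutral[THEN trans]) auto
  qed
  also have "c ?i = complex_of_real (sqrt ((J - u_of (n1, n2, n3)) * (J + u_of (n1, n2, n3) + 1)))"
    by (simp add: c_def u_of_def field_simps)
  finally show ?thesis by simp
qed

text \<open>Read downwards, the string of \<open>E k \<nu> J\<close> is a ladder for
  \<open>U_minus\<close>. Read upwards it is a ladder for \<open>U_plus\<close>, which the adjoint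
  turns into one for \<open>U_minus\<close> with the two distances exchanged.\<close>

lemma coupled_basis_ladder_position:
  assumes rep: "su3_unitary_rep \<pi> \<rho>"
    and onb: "orthonormal_basis (coupled_labels m) (\<lambda>(k, \<nu>, J). E k \<nu> J)"
    and gt: "\<And>k. k \<in> cg_series m \<Longrightarrow> gt_basis (tensor_dual_alg \<rho>) (W k) (fst k) (E k)"
    and k: "k \<in> cg_series m" and lab: "(\<nu>, J) \<in> gt_labels (fst k)"
  obtains r l where "J - u_of \<nu> = real r" "J + u_of \<nu> = real l"
    "ladder_position (U_minus \<rho>) r l (to_op (E k \<nu> J))"
    "ladder_position (U_minus \<rho>) l r (adj (to_op (E k \<nu> J)))"
proof -
  obtain n1 n2 n3 where \<nu>: "\<nu> = (n1, n2, n3)" by (cases \<nu>)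
  obtain r l :: nat where rl: "J - u_of (n1, n2, n3) = r" "J + u_of (n1, n2, n3) = l"
    "\<And>i. i \<le> r + l \<Longrightarrow> ((n1, n2 + int r - int i, n3 - int r + int i), J) \<in> gt_labels (fst k)"
    using gt_string[OF lab[unfolded \<nu>]] by metis
  \<comment> \<open>Labels are numbered from the top of the string, where u = J; the given label has
    number \<open>r\<close>.\<close>
  define w where "w = (\<lambda>i::nat. (n1, n2 + int r - int i, n3 - int r + int i))"
  define x where "x = (\<lambda>i. to_op (E k (w i) J))"
  define c where "c = (\<lambda>i. complex_of_real (sqrt ((real (r + l) - real i) * (real i + 1))))"
  have u: "u_of (w i) = J - real i" for i
    using rl(1) by (simp add: w_def u_of_def field_simps)
  have J: "2 * J = real (r + l)" using rl(1,2) by linarith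
  have c_nz: "c (r + l) = 0" "\<And>i. i < r + l \<Longrightarrow> c i \<noteq> 0" by (auto simp: c_def)
  have x_r: "x r = to_op (E k \<nu> J)" by (simp add: x_def w_def \<nu>)
  have "ladder_position (U_minus \<rho>) r l (x r)"
  proof (rule ladder_positionI[where x = x and c = c, OF _ c_nz refl])
    fix i assume "i \<le> r + l"
    then have "(w i, J) \<in> gt_labels (fst k)" using rl(3) by (simp add: w_def)
    from gt_basis_U_minus[OF gt[OF k] this[unfolded w_def]]
    have "U_minus (tensor_dual_alg \<rho>) *v E k (w i) J
      = complex_of_real (sqrt ((J + u_of (w i)) * (J - u_of (w i) + 1))) *s E k (w (Suc i)) J"
      by (simp add: w_def algebra_simps)
    also have "(J + u_of (w i)) * (J - u_of (w i) + 1) = (real (r + l) - real i) * (real i + 1)"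
      using J by (intro arg_cong2[where f = "(*)"]) (simp_all add: u)
    finally show "commutator (U_minus \<rho>) (x i) = cscale (c i) (x (Suc i))"
      by (simp add: x_def c_def U_minus_def flip: to_op_tensor_dual_alg to_op_scale)
  qed
  moreover have "ladder_position (U_plus \<rho>) l r (x (r + l - l))"
  proof (rule ladder_positionI[where x = "\<lambda>i. x (r + l - i)" and c = c, OF _ c_nz])
    fix i assume i: "i \<le> r + l"
    define j where "j = r + l - i"
    then have "(w j, J) \<in> gt_labels (fst k)" using rl(3) by (simp add: w_def)
    from coupled_basis_U_plus[OF onb gt k this[unfolded w_def]]
    have "U_plus (tensor_dual_alg \<rho>) *v E k (w j) J
      = complex_of_real (sqrt ((J - u_of (w j)) * (J + u_of (w j) + 1))) *s
         E k (n1, n2 + int r - int j + 1, n3 - int r + int j - 1) J"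
      by (simp add: w_def adj_U_minus_tensor[OF rep])
    also have "(J - u_of (w j)) * (J + u_of (w j) + 1) = (real (r + l) - real i) * (real i + 1)"
      using i J by (intro arg_cong2[where f = "(*)"]) (simp_all add: u j_def of_nat_diff)
    also have "complex_of_real (sqrt ((real (r + l) - real i) * (real i + 1))) *s
         E k (n1, n2 + int r - int j + 1, n3 - int r + int j - 1) J = c i *s E k (w (r + l - Suc i)) J"
    \<comment> \<open>At the top end the truncated subtraction gives label 0 instead of a label
      above it; the coefficient \<open>c i\<close> is zero there.\<close>
    proof (cases "i = r + l")
      case False
      then have "int (r + l - Suc i) = int j - 1" using i by (simp add: j_def)
      then have "w (r + l - Suc i) = (n1, n2 + int r - int j + 1, n3 - int r + int j - 1)"
        unfolding w_def by simp
      then show ?thesis by (simp only: c_def)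
    qed (simp add: c_def)
    finally show "commutator (U_plus \<rho>) (x (r + l - i)) = cscale (c i) (x (r + l - Suc i))"
      by (simp add: x_def j_def U_plus_def flip: to_op_tensor_dual_alg to_op_scale)
  qed (simp_all add: add.commute)
  then have "ladder_position (U_minus \<rho>) l r (adj (x r))"
    by (intro ladder_position_adj) (simp add: adj_U_minus[OF rep])
  ultimately show thesis using that rl(1,2) by (simp add: x_r \<nu>)
qed


section \<open>The product expansion\<close>

text \<open>The Parseval identity is inserted twice between the factors; reordering the sums gives
  the index pattern of the Wigner symbol.\<close>

lemma orthonormal_basis_trace_triple:
  assumes onb: "orthonormal_basis I b"
  shows "trace (adj F ** (A ** B)) = (\<Sum>i\<in>I. \<Sum>j\<in>I. \<Sum>l\<in>I.
    cinner (b i) (A *v b j) * cinner (b j) (B *v b l) * cnj (cinner (b i) (F *v b l)))"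
proof -
  have "trace (adj F ** (A ** B)) = (\<Sum>l\<in>I. cinner (F *v b l) (A *v (B *v b l)))"
    by (subst orthonormal_basis_trace[OF onb])
      (simp only: matrix_vector_mul_assoc[symmetric] cinner_adj[of _ "adj F"] adj_adj)
  also have "\<dots> = (\<Sum>l\<in>I. \<Sum>i\<in>I. cinner (F *v b l) (b i) * cinner (adj A *v b i) (B *v b l))"
    by (subst orthonormal_basis_parseval[OF onb]) (simp only: cinner_adj[of _ A])
  also have "\<dots> = (\<Sum>l\<in>I. \<Sum>i\<in>I. \<Sum>j\<in>I.
      cinner (b i) (A *v b j) * cinner (b j) (B *v b l) * cnj (cinner (b i) (F *v b l)))"
    by (subst orthonormal_basis_parseval[OF onb, of "adj A *v _"])
      (simp only: cinner_adj[of _ A] cinner_commute sum_distrib_left mult_ac)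
  also have "\<dots> = (\<Sum>i\<in>I. \<Sum>l\<in>I. \<Sum>j\<in>I.
      cinner (b i) (A *v b j) * cinner (b j) (B *v b l) * cnj (cinner (b i) (F *v b l)))"
    by (rule sum.swap)
  also have "\<dots> = (\<Sum>i\<in>I. \<Sum>j\<in>I. \<Sum>l\<in>I.
      cinner (b i) (A *v b j) * cinner (b j) (B *v b l) * cnj (cinner (b i) (F *v b l)))"
    by (intro sum.cong refl sum.swap)
  finally show ?thesis .
qed

text \<open>The tensor is the rank-one operator that sends v to \<open>cinner y v *s x\<close>, and
  pairing with it extracts a matrix element.\<close>

lemma cinner_tensor_dual:
  "cinner w (tensor_vec x (dual_vec y)) = cnj (cinner x (to_op w *v y))"
proof -
  have "cinner w (tensor_vec x (dual_vec y)) = (\<Sum>i\<in>UNIV. \<Sum>j\<in>UNIV. cnj (w $ (i, j)) * (x $ i * cnj (y $ j)))"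
    unfolding cinner_def UNIV_Times_UNIV[symmetric] sum.cartesian_product
    by (simp add: tensor_vec_def dual_vec_def case_prod_beta)
  then show ?thesis
    by (simp add: cinner_def matrix_vector_mult_def to_op_def sum_distrib_left mult_ac)
qed

lemma tensor_vec_scale_right: "tensor_vec x (c *s y) = c *s tensor_vec x y"
  by (simp add: tensor_vec_def vec_eq_iff)

text \<open>Clebsch-Gordan coefficients are conjugated matrix elements of the basis operators, up to
  a sign; the check negates its exponent and so preserves its parity.\<close>

lemma cg_coeff_eq:
  "cg_coeff p e E k \<nu>1 J1 \<nu>2 J2 \<nu> J = (-1) powi two_tu \<nu>2 *
     cnj (cinner (e \<nu>1 J1) (to_op (E k \<nu> J) *v e (check_weight (size_of p) \<nu>2) J2))"
proof -
  have "two_tu (check_weight (size_of p) \<nu>2) = - two_tu \<nu>2"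
    by (simp add: two_tu_def check_weight_def)
  then show ?thesis
    by (simp add: cg_coeff_def induced_dual_basis_def tensor_vec_scale_right cinner_scale_right cinner_tensor_dual power_int_minus_one_minus)
qed

lemma cg_coeff_real_eq:
  assumes "cg_coeff p e E k \<nu>1 J1 \<nu>2 J2 \<nu> J \<in> \<real>"
  shows "cg_coeff p e E k \<nu>1 J1 \<nu>2 J2 \<nu> J = (-1) powi two_tu \<nu>2 *
     cinner (e \<nu>1 J1) (to_op (E k \<nu> J) *v e (check_weight (size_of p) \<nu>2) J2)"
  using assms[unfolded Reals_cnj_iff] unfolding cg_coeff_eq
  by (metis complex_cnj_cnj complex_cnj_mult complex_cnj_minus complex_cnj_one complex_cnj_power_int)

text \<open>Reality removes the conjugates from the first two coefficients, while the third keeps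
  its own, as the trace against an adjoint requires.\<close>

lemma wigner_symbol_eq:
  assumes onb: "orthonormal_basis (gt_labels p) (\<lambda>(\<nu>, J). e \<nu> J)"
    and real1: "\<And>\<mu> I \<mu>' I'. (\<mu>, I) \<in> gt_labels p \<Longrightarrow> (\<mu>', I') \<in> gt_labels (prod.swap p) \<Longrightarrow>
      cg_coeff p e E k1 \<mu> I \<mu>' I' \<nu>1 J1 \<in> \<real>"
    and real2: "\<And>\<mu> I \<mu>' I'. (\<mu>, I) \<in> gt_labels p \<Longrightarrow> (\<mu>', I') \<in> gt_labels (prod.swap p) \<Longrightarrow>
      cg_coeff p e E k2 \<mu> I \<mu>' I' \<nu>2 J2 \<in> \<real>"
  shows "(-1) powi (size_of p + two_tu \<nu>) *
      wigner_symbol p e E k1 k2 k \<nu>1 J1 \<nu>2 J2 (check_weight (size_of (fst k)) \<nu>) J =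
    trace (adj (to_op (E k \<nu> J)) ** (to_op (E k1 \<nu>1 J1) ** to_op (E k2 \<nu>2 J2)))"
proof -
  let ?s = "size_of p" and ?L = "gt_labels p" and ?L' = "gt_labels (prod.swap p)"
  let ?h = "\<lambda>(\<nu>, J). (check_weight ?s \<nu>, J :: real)"
  let ?b = "\<lambda>(\<nu>, J). e \<nu> J"
  define G where "G = (\<lambda>i j l. cinner (?b i) (to_op (E k1 \<nu>1 J1) *v ?b j) *
    cinner (?b j) (to_op (E k2 \<nu>2 J2) *v ?b l) * cnj (cinner (?b i) (to_op (E k \<nu> J) *v ?b l)))"
  have "two_tu (check_weight (size_of (fst k)) \<nu>) = - two_tu \<nu>"
    by (simp add: two_tu_def check_weight_def)
  \<comment> \<open>Each sign occurs twice: that of \<open>\<mu>2\<close> in the symbol and the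
    first coefficient, that of \<open>\<mu>3\<close> in the last two coefficients, and the global
    one outside and inside the symbol.\<close>
  then have sign: "(-1) powi (?s + two_tu \<nu>) *
     ((-1) powi (?s + two_tu (check_weight (size_of (fst k)) \<nu>) + two_tu \<mu>2) *
       ((-1) powi two_tu \<mu>2 * X) * ((-1) powi two_tu \<mu>3 * Y) * ((-1) powi two_tu \<mu>3 * Z)) = X * Y * Z"
    for \<mu>2 \<mu>3 and X Y Z :: complex
    by (simp add: power_int_minus_one_minus power_int_add diff_conv_add_uminus mult_ac del: add_uminus_conv_diff)
  have mem: "?h x \<in> ?L" if "x \<in> ?L'" for x
    using bij_betwE[OF bij_check_weight[of p]] that by auto
  have "(-1) powi (?s + two_tu \<nu>) *
      wigner_symbol p e E k1 k2 k \<nu>1 J1 \<nu>2 J2 (check_weight (size_of (fst k)) \<nu>) J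
    = (\<Sum>i\<in>?L. \<Sum>j\<in>?L'. \<Sum>l\<in>?L'. G i (?h j) (?h l))"
    unfolding wigner_symbol_def sum_distrib_left case_prod_beta
  proof (intro sum.cong refl)
    fix i j l assume ijl: "i \<in> ?L" "j \<in> ?L'" "l \<in> ?L'"
    obtain \<mu>1 I1 \<mu>2 I2 \<mu>3 I3 where eq: "i = (\<mu>1, I1)" "j = (\<mu>2, I2)" "l = (\<mu>3, I3)"
      by (metis surj_pair)
    have "(check_weight ?s \<mu>2, I2) \<in> ?L" using mem[OF ijl(2)] by (simp add: eq)
    then have cg: "cg_coeff p e E k1 \<mu>1 I1 \<mu>2 I2 \<nu>1 J1 = (-1) powi two_tu \<mu>2 *
          cinner (e \<mu>1 I1) (to_op (E k1 \<nu>1 J1) *v e (check_weight ?s \<mu>2) I2)"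
      "cg_coeff p e E k2 (check_weight ?s \<mu>2) I2 \<mu>3 I3 \<nu>2 J2 = (-1) powi two_tu \<mu>3 *
          cinner (e (check_weight ?s \<mu>2) I2) (to_op (E k2 \<nu>2 J2) *v e (check_weight ?s \<mu>3) I3)"
      using ijl by (auto simp: eq intro!: cg_coeff_real_eq real1 real2)
    show "(-1) powi (?s + two_tu \<nu>) *
       ((-1) powi (?s + two_tu (check_weight (size_of (fst k)) \<nu>) + two_tu (fst j)) *
        cg_coeff p e E k1 (fst i) (snd i) (fst j) (snd j) \<nu>1 J1 *
        cg_coeff p e E k2 (check_weight ?s (fst j)) (snd j) (fst l) (snd l) \<nu>2 J2 *
        cg_coeff p e E k (fst i) (snd i) (fst l) (snd l)
          (check_weight (size_of (fst k)) (check_weight (size_of (fst k)) \<nu>)) J)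
      = G i (check_weight ?s (fst j), snd j) (check_weight ?s (fst l), snd l)"
      unfolding eq fst_conv snd_conv cg cg_coeff_eq[of _ _ _ k] check_weight_involutive sign
      by (simp add: G_def)
  qed
  \<comment> \<open>The check maps the labels of the dual irrep bijectively onto those of
    \<open>p\<close>, which reindexes the two inner sums.\<close>
  also have "\<dots> = (\<Sum>i\<in>?L. \<Sum>j\<in>?L. \<Sum>l\<in>?L. G i j l)"
    by (simp only: sum.reindex_bij_betw[OF bij_check_weight[of p], of "G _ _"]
      sum.reindex_bij_betw[OF bij_check_weight[of p], of "\<lambda>j. \<Sum>l\<in>?L. G _ j l"])
  also have "\<dots> = trace (adj (to_op (E k \<nu> J)) ** (to_op (E k1 \<nu>1 J1) ** to_op (E k2 \<nu>2 J2)))"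
    unfolding G_def by (rule orthonormal_basis_trace_triple[OF onb, symmetric])
  finally show ?thesis .
qed

text \<open>A derivation adds eigenvalues on products, so \<open>z\<close> is an eigenvector and has
  components only along basis vectors with the same eigenvalue.\<close>

lemma product_weight:
  assumes "\<And>k \<nu> J. k \<in> cg_series m \<Longrightarrow> (\<nu>, J) \<in> gt_labels (fst k) \<Longrightarrow>
      tensor_dual_alg \<rho> X *v E k \<nu> J = complex_of_real (f \<nu>) *s E k \<nu> J"
    and onb: "orthonormal_basis (coupled_labels m) (\<lambda>(k, \<nu>, J). E k \<nu> J)"
    and k: "k1 \<in> cg_series m" "k2 \<in> cg_series m" "k \<in> cg_series m"
    and lab: "(\<nu>1, J1) \<in> gt_labels (fst k1)" "(\<nu>2, J2) \<in> gt_labels (fst k2)" "(\<nu>, J) \<in> gt_labels (fst k)"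
    and z: "to_op z = to_op (E k1 \<nu>1 J1) ** to_op (E k2 \<nu>2 J2)"
    and nz: "cinner (E k \<nu> J) z \<noteq> 0"
  shows "f \<nu> = f \<nu>1 + f \<nu>2"
proof -
  let ?H = "tensor_dual_alg \<rho> X"
  have "commutator (\<rho> X) (to_op (E k1 \<nu>1 J1)) = cscale (of_real (f \<nu>1)) (to_op (E k1 \<nu>1 J1))"
    "commutator (\<rho> X) (to_op (E k2 \<nu>2 J2)) = cscale (of_real (f \<nu>2)) (to_op (E k2 \<nu>2 J2))"
    using assms(1)[OF k(1) lab(1)] assms(1)[OF k(2) lab(2)]
    by (simp_all flip: to_op_tensor_dual_alg to_op_scale)
  then have "?H *v z = complex_of_real (f \<nu>1 + f \<nu>2) *s z"
    unfolding to_op_inject[symmetric] to_op_tensor_dual_alg to_op_scale z commutator_mult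
    by (simp add: cscale_mult_left cscale_mult_right) (simp add: cscale_def vec_eq_iff algebra_simps)
  then have "complex_of_real (case (k, \<nu>, J) of (k, \<nu>, J) \<Rightarrow> f \<nu>) = complex_of_real (f \<nu>1 + f \<nu>2)"
    by (rule orthonormal_basis_eigenvalue[OF onb, where i = "(k, \<nu>, J)", rotated])
       (use assms(1) k(3) lab(3) nz in \<open>auto simp: coupled_labels_def\<close>)
  then show ?thesis by (simp only: of_real_eq_iff case_prod_conv)
qed

theorem theorem2p20:
  fixes p :: "nat \<times> nat"
    and \<pi> \<rho> :: "complex^3^3 \<Rightarrow> complex^'n^'n"
    and e :: "weight \<Rightarrow> real \<Rightarrow> complex^'n"
    and m :: "nat \<times> nat \<Rightarrow> nat"
    and E :: "irrep_index \<Rightarrow> weight \<Rightarrow> real \<Rightarrow> complex^('n \<times> 'n)"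
    and a1 a2 :: "nat \<times> nat" and \<sigma>1 \<sigma>2 :: nat
    and \<nu>1 \<nu>2 :: weight and J1 J2 :: real
  assumes "su3_unitary_rep \<pi> \<rho>"
    and "irrep_of_class \<pi> \<rho> UNIV p"
    and "gt_basis \<rho> UNIV p e"
    and "coupled_basis \<pi> \<rho> p e m E"
    and "(a1, \<sigma>1) \<in> cg_series m" and "(\<nu>1, J1) \<in> gt_labels a1"
    and "(a2, \<sigma>2) \<in> cg_series m" and "(\<nu>2, J2) \<in> gt_labels a2"
  shows "to_op (E (a1, \<sigma>1) \<nu>1 J1) ** to_op (E (a2, \<sigma>2) \<nu>2 J2) =
      (\<Sum>(a, \<sigma>)\<in>cg_series m. \<Sum>(\<nu>, J)\<in>gt_labels a.
         cscale ((-1) powi (size_of p + two_tu \<nu>) *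
             wigner_symbol p e E (a1, \<sigma>1) (a2, \<sigma>2) (a, \<sigma>)
               \<nu>1 J1 \<nu>2 J2 (check_weight (size_of a) \<nu>) J)
           (to_op (E (a, \<sigma>) \<nu> J))) \<and>
    (\<forall>(a, \<sigma>)\<in>cg_series m. \<forall>(\<nu>, J)\<in>gt_labels a.
      \<not> (t_of \<nu> = t_of \<nu>1 + t_of \<nu>2 \<and> u_of \<nu> = u_of \<nu>1 + u_of \<nu>2 \<and> delta J1 J2 J = 1) \<longrightarrow>
      wigner_symbol p e E (a1, \<sigma>1) (a2, \<sigma>2) (a, \<sigma>)
        \<nu>1 J1 \<nu>2 J2 (check_weight (size_of a) \<nu>) J = 0)"
proof -
  define k1 k2 where "k1 = (a1, \<sigma>1)" and "k2 = (a2, \<sigma>2)"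
  note rep = assms(1)
  have k: "k1 \<in> cg_series m" "k2 \<in> cg_series m"
    and lab: "(\<nu>1, J1) \<in> gt_labels (fst k1)" "(\<nu>2, J2) \<in> gt_labels (fst k2)"
    using assms by (auto simp: k1_def k2_def)
  obtain W where dec: "orthogonal_irrep_decomposition (tensor_dual_grp \<pi>) (tensor_dual_alg \<rho>) m W"
    and gt: "\<And>k. k \<in> cg_series m \<Longrightarrow> gt_basis (tensor_dual_alg \<rho>) (W k) (fst k) (E k)"
    using assms(4) unfolding coupled_basis_def by blast
  have real: "cg_coeff p e E k \<mu> I \<mu>' I' \<nu> J \<in> \<real>"
    if "k \<in> cg_series m" "(\<nu>, J) \<in> gt_labels (fst k)" "(\<mu>, I) \<in> gt_labels p" "(\<mu>', I') \<in> gt_labels (prod.swap p)"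
    for k \<nu> J \<mu> I \<mu>' I'
    using assms(4) that unfolding coupled_basis_def by blast
  note onb = coupled_basis_orthonormal[OF dec gt]
  let ?A = "to_op (E k1 \<nu>1 J1)" and ?B = "to_op (E k2 \<nu>2 J2)"
  obtain z where z: "to_op z = ?A ** ?B" using to_op_surj by blast
  let ?w = "\<lambda>k \<nu> J. wigner_symbol p e E k1 k2 k \<nu>1 J1 \<nu>2 J2 (check_weight (size_of (fst k)) \<nu>) J"
  have tr: "cinner (E k \<nu> J) z = trace (adj (to_op (E k \<nu> J)) ** (?A ** ?B))" for k \<nu> J
    by (simp add: cinner_to_op z)
  have w: "(-1) powi (size_of p + two_tu \<nu>) * ?w k \<nu> J = cinner (E k \<nu> J) z" for k \<nu> J
    unfolding tr by (intro wigner_symbol_eq gt_basis_orthonormal[OF assms(3)] real k lab)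
  have "?A ** ?B = (\<Sum>(k, \<nu>, J)\<in>coupled_labels m. cscale (cinner (E k \<nu> J) z) (to_op (E k \<nu> J)))"
    using arg_cong[OF orthonormal_basis_expansion[OF onb, of z], of to_op]
    by (simp add: z to_op_sum to_op_scale case_prod_beta)
  also have "\<dots> = (\<Sum>k\<in>cg_series m. \<Sum>(\<nu>, J)\<in>gt_labels (fst k).
      cscale ((-1) powi (size_of p + two_tu \<nu>) * ?w k \<nu> J) (to_op (E k \<nu> J)))"
    unfolding w coupled_labels_def using dec
    by (subst sum.Sigma) (auto simp: orthogonal_irrep_decomposition_def finite_gt_labels)
  finally have expansion: "?A ** ?B = \<dots>" .
  have vanish: "t_of \<nu> = t_of \<nu>1 + t_of \<nu>2 \<and> u_of \<nu> = u_of \<nu>1 + u_of \<nu>2 \<and> delta J1 J2 J = 1"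
    if k': "k \<in> cg_series m" "(\<nu>, J) \<in> gt_labels (fst k)" and nz: "?w k \<nu> J \<noteq> 0" for k \<nu> J
  proof -
    have c: "cinner (E k \<nu> J) z \<noteq> 0" using nz unfolding w[symmetric] by simp
    have t: "t_of \<nu> = t_of \<nu>1 + t_of \<nu>2"
      using gt_basis_weight(1)[OF rep gt]
      by (intro product_weight[OF _ onb k k'(1) lab k'(2) z c]) (auto simp: T_three_def)
    have u: "u_of \<nu> = u_of \<nu>1 + u_of \<nu>2"
      using gt_basis_weight(2)[OF rep gt]
      by (intro product_weight[OF _ onb k k'(1) lab k'(2) z c]) (auto simp: U_three_def)
    let ?f = "U_minus \<rho>" and ?F = "adj (to_op (E k \<nu> J))"
    obtain r1 l1 where 1: "J1 - u_of \<nu>1 = real r1" "J1 + u_of \<nu>1 = real l1" "ladder_position ?f r1 l1 ?A"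
      using coupled_basis_ladder_position[OF rep onb gt k(1) lab(1)] by metis
    obtain r2 l2 where 2: "J2 - u_of \<nu>2 = real r2" "J2 + u_of \<nu>2 = real l2" "ladder_position ?f r2 l2 ?B"
      using coupled_basis_ladder_position[OF rep onb gt k(2) lab(2)] by metis
    obtain r l where 3: "J - u_of \<nu> = real r" "J + u_of \<nu> = real l" "ladder_position ?f l r ?F"
      using coupled_basis_ladder_position[OF rep onb gt k'] by metis
    have "trace (?F ** (?A ** ?B)) \<noteq> 0" using c by (simp add: tr)
    \<comment> \<open>Cyclic rotation lets each of the three operators take the first place, which
      yields one triangle inequality each.\<close>
    moreover from this have "trace (?A ** (?B ** ?F)) \<noteq> 0" "trace (?B ** (?F ** ?A)) \<noteq> 0"
      by (metis trace_mul_sym matrix_mul_assoc)+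
    ultimately have "l \<le> l1 + l2" "r1 \<le> l2 + r" "r2 \<le> r + l1"
      using trace_ladder_positions[OF 3(3) 1(3) 2(3)] trace_ladder_positions[OF 1(3) 2(3) 3(3)]
        trace_ladder_positions[OF 2(3) 3(3) 1(3)] by auto
    then have "real l \<le> real l1 + real l2" "real r1 \<le> real l2 + real r" "real r2 \<le> real r + real l1"
      by linarith+
    \<comment> \<open>The weights cancel because u = u1 + u2, leaving only the spins.\<close>
    then have "J \<le> J1 + J2" "J1 \<le> J2 + J" "J2 \<le> J1 + J"
      using 1(1,2) 2(1,2) 3(1,2) u by linarith+
    \<comment> \<open>The sum (J1 - u1) + (J2 - u2) + (J + u) of ladder distances is an integer in
      which the weights cancel.\<close>
    moreover have "J1 + J2 + J = real (r1 + r2 + l)"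
      using 1(1) 2(1) 3(2) u by simp
    ultimately have "delta J1 J2 J = 1" by (simp add: delta_def)
    with t u show ?thesis by blast
  qed
  show ?thesis
  proof (intro conjI)
    show "to_op (E (a1, \<sigma>1) \<nu>1 J1) ** to_op (E (a2, \<sigma>2) \<nu>2 J2) =
      (\<Sum>(a, \<sigma>)\<in>cg_series m. \<Sum>(\<nu>, J)\<in>gt_labels a.
         cscale ((-1) powi (size_of p + two_tu \<nu>) *
             wigner_symbol p e E (a1, \<sigma>1) (a2, \<sigma>2) (a, \<sigma>)
               \<nu>1 J1 \<nu>2 J2 (check_weight (size_of a) \<nu>) J)
           (to_op (E (a, \<sigma>) \<nu> J)))"
      using expansion by (simp add: k1_def k2_def case_prod_beta)
  qed (use vanish in \<open>fastforce simp: k1_def k2_def\<close>)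
qed

end
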